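(* Assume $\dim\mathfrak X<\infty$ and let $\{V_n:n\in\mathbb N\}$ be a sequence of uncorrelated and compactly uniformly integrable (in $L^1$) $\mathcal P_{kc}(\mathfrak X)$-valued random variables. Suppose that $V_n\in L^2(\Omega;\mathcal P_{kc}(\mathfrak X))$ for each $n$, and that there is a positive constant $M$, not depending on $x^*$ or $n$, such that $\mathrm{Var}(\sigma(x^*,V_n))\le M$ for all $n\in\mathbb N$ and all $x^*\in S^*$. Then $$d_H\Big(\frac1n\sum_{k=1}^n V_k,\ \frac1n\sum_{k=1}^n E[V_k]\Big)\longrightarrow 0\quad\text{as } n\to\infty,\ \text{a.s.}$$
   Context: $(\Omega,\mathcal A,\mu)$ is a complete, non-atomic probability space; $E$, $\mathrm{Var}$, $\mathrm{cov}$ and "a.s." are with respect to $\mu$. $(\mathfrak X,\|\cdot\|)$ is a real separable Banach space with dual $(\mathfrak X^*,\|\cdot\|_{\mathfrak X^*})$, and $S^*$ is the unit sphere of $\mathfrak X^*$. $\mathcal P_k(\mathfrak X)$ (resp. $\mathcal P_{kc}(\mathfrak X)$) is the family of nonempty compact (resp. compact convex) subsets of $\mathfrak X$. $A+B=\{a+b:a\in A,b\in B\}$, $\lambda A=\{\lambda a:a\in A\}$; sums of sets are Minkowski sums. The Hausdorff metric is $d_H(A,B)=\max\{\sup_{a\in A}\inf_{b\in B}\|a-b\|,\ \sup_{b\in B}\inf_{a\in A}\|a-b\|\}$, and $\|A\|_{\mathcal P}=d_H(\{0\},A)=\sup_{a\in A}\|a\|$. The support function is $\sigma(x^*,A)=\sup_{a\in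 A}\langle x^*,a\rangle$, $x^*\in\mathfrak X^*$. A set-valued random variable is a map $F$ from $\Omega$ to the nonempty closed subsets of $\mathfrak X$ with $\{\omega:F(\omega)\cap O\neq\emptyset\}\in\mathcal A$ for every open $O\subset\mathfrak X$; it is $\mathcal P_{kc}(\mathfrak X)$-valued if all its values lie in $\mathcal P_{kc}(\mathfrak X)$. $L^p(\Omega;\mathcal P_{kc}(\mathfrak X))$ is the set of $\mathcal P_{kc}(\mathfrak X)$-valued random variables $F$ with $\int_\Omega\|F(\omega)\|_{\mathcal P}^p\,d\mu<\infty$. The expectation of $F$ is the Aumann integral $E[F]=\{E[f]:f\in S_F\}$, where $S_F$ is the set of Bochner integrable $f:\Omega\to\mathfrak X$ with $f(\omega)\in F(\omega)$ a.s. Real random variables $\xi,\eta$ are uncorrelated if $\mathrm{cov}(\xi,\eta)=0$. A sequence of set-valued random variables $\{F_1,F_2,\dots\}$ is (pairwise) uncorrelated if for every $x^*\in\mathfrak X^*$ the real random variables $\sigma(x^*,F_1),\sigma(x^*,F_2),\dots$ are pairwise uncorrelated. A sequence $\{F_n\}$ of $\mathcal P_k(\mathfrak X)$-valued random variables is compactly uniformly integrable in $L^p$ ($p\ge1$) if for each $\epsilon>0$ there is a compact subset $\mathcal K_\epsilon$ of the metric space $(\mathcal P_k(\mathfrak X),d_H)$ such that $E\big[\|F_n\|_{\mathcal P}^p\, I_{\{F_n\notin\mathcal K_\epsilon\}}\big]<\epsilon$ for all $n$, where $I$ is the indicator function. *)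

theory Defs
  imports "HOL-Probability.Probability" "HOL-Library.Set_Algebras"
begin

definition nonatomic :: "'w measure \<Rightarrow> bool" where
  "nonatomic M \<longleftrightarrow>
     (\<forall>A\<in>sets M. emeasure M A > 0 \<longrightarrow>
        (\<exists>B\<in>sets M. B \<subseteq> A \<and> 0 < emeasure M B \<and> emeasure M B < emeasure M A))"

definition Pk :: "'a::real_normed_vector set set" where
  "Pk = {A. A \<noteq> {} \<and> compact A}"

definition Pkc :: "'a::real_normed_vector set set" where
  "Pkc = {A \<in> Pk. convex A}"

(* The suprema below are suprema of reals; they are only meaningful for nonempty bounded sets. *)

definition hausdorff_dist :: "'a::real_normed_vector set \<Rightarrow> 'a set \<Rightarrow> real" where
  "hausdorff_dist A B =
     max (SUP a\<in>A. INF b\<in>B. norm (a - b)) (SUP b\<in>B. INF a\<in>A. norm (a - b))"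

(* Metric_space demands nonnegativity and symmetry for all arguments, also outside the carrier. *)
definition Pk_dist :: "'a::real_normed_vector set \<Rightarrow> 'a set \<Rightarrow> real" where
  "Pk_dist A B = (if A \<in> Pk \<and> B \<in> Pk then hausdorff_dist A B else 0)"

definition set_norm :: "'a::real_normed_vector set \<Rightarrow> real" where
  "set_norm A = hausdorff_dist {0} A"

definition support_fun :: "('a::real_normed_vector \<Rightarrow>\<^sub>L real) \<Rightarrow> 'a set \<Rightarrow> real" where
  "support_fun x A = (SUP a\<in>A. blinfun_apply x a)"

definition set_random_variable ::
  "'w measure \<Rightarrow> ('w \<Rightarrow> 'a::real_normed_vector set) \<Rightarrow> bool" where
  "set_random_variable M F \<longleftrightarrow>
     (\<forall>\<omega>\<in>space M. F \<omega> \<noteq> {} \<and> closed (F \<omega>)) \<and>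
     (\<forall>U. open U \<longrightarrow> {\<omega>\<in>space M. F \<omega> \<inter> U \<noteq> {}} \<in> sets M)"

definition Pkc_random_variable ::
  "'w measure \<Rightarrow> ('w \<Rightarrow> 'a::real_normed_vector set) \<Rightarrow> bool" where
  "Pkc_random_variable M F \<longleftrightarrow>
     set_random_variable M F \<and> (\<forall>\<omega>\<in>space M. F \<omega> \<in> Pkc)"

definition Lp_Pkc :: "real \<Rightarrow> 'w measure \<Rightarrow> ('w \<Rightarrow> 'a::real_normed_vector set) set" where
  "Lp_Pkc p M =
     {F. Pkc_random_variable M F \<and> (\<integral>\<^sup>+\<omega>. ennreal (set_norm (F \<omega>) powr p) \<partial>M) < \<infinity>}"

definition aumann_expectation ::
  "'w measure \<Rightarrow> ('w \<Rightarrow> 'a::{banach, second_countable_topology} set) \<Rightarrow> 'a set" where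
  "aumann_expectation M F =
     {integral\<^sup>L M f |f. integrable M f \<and> (AE \<omega> in M. f \<omega> \<in> F \<omega>)}"

(* To be used for square integrable variables only: the Bochner integral of a
   non-integrable function is 0. *)
definition covariance :: "'w measure \<Rightarrow> ('w \<Rightarrow> real) \<Rightarrow> ('w \<Rightarrow> real) \<Rightarrow> real" where
  "covariance M X Y =
     integral\<^sup>L M (\<lambda>\<omega>. (X \<omega> - integral\<^sup>L M X) * (Y \<omega> - integral\<^sup>L M Y))"

definition uncorrelated_seq ::
  "'w measure \<Rightarrow> (nat \<Rightarrow> 'w \<Rightarrow> 'a::real_normed_vector set) \<Rightarrow> bool" where
  "uncorrelated_seq M F \<longleftrightarrow>
     (\<forall>x. \<forall>i j. i \<noteq> j \<longrightarrow>
        covariance M (\<lambda>\<omega>. support_fun x (F i \<omega>)) (\<lambda>\<omega>. support_fun x (F j \<omega>)) = 0)"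

definition compactly_uniformly_integrable ::
  "real \<Rightarrow> 'w measure \<Rightarrow> (nat \<Rightarrow> 'w \<Rightarrow> 'a::real_normed_vector set) \<Rightarrow> bool" where
  "compactly_uniformly_integrable p M F \<longleftrightarrow>
     (\<forall>\<epsilon>>0. \<exists>K. compactin (Metric_space.mtopology Pk Pk_dist) K \<and>
        (\<forall>n. (\<integral>\<^sup>+\<omega>. ennreal (set_norm (F n \<omega>) powr p) * indicator {\<omega>. F n \<omega> \<notin> K} \<omega> \<partial>M)
              < ennreal \<epsilon>))"

text \<open>The facts below confirm that \<open>Pk_dist\<close> is a metric on the nonempty compact sets
  (so that \<open>Metric_space.mtopology\<close> above is its metric topology) and that \<open>set_norm\<close> is the
  supremum of the norms.\<close>

lemma INF_norm_eq_infdist: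
  fixes a :: "'a::real_normed_vector"
  assumes "B \<noteq> {}"
  shows "(INF b\<in>B. norm (a - b)) = infdist a B"
  using assms by (simp add: infdist_notempty dist_norm)

lemma hausdorff_dist_infdist:
  fixes A B :: "'a::real_normed_vector set"
  assumes "A \<noteq> {}" "B \<noteq> {}"
  shows "hausdorff_dist A B = max (SUP a\<in>A. infdist a B) (SUP b\<in>B. infdist b A)"
proof -
  have "(INF a\<in>A. norm (a - b)) = infdist b A" for b
    using INF_norm_eq_infdist[OF assms(1), of b] by (simp add: norm_minus_commute)
  then show ?thesis
    unfolding hausdorff_dist_def using INF_norm_eq_infdist[OF assms(2)] by simp
qed

lemma bdd_above_infdist:
  fixes A B :: "'a::real_normed_vector set"
  assumes "compact A"
  shows "bdd_above ((\<lambda>a. infdist a B) ` A)"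
  using assms
  by (intro bounded_imp_bdd_above compact_imp_bounded compact_continuous_image
        continuous_on_infdist continuous_on_id)

lemma infdist_le_hausdorff_dist:
  assumes "A \<in> Pk" "B \<in> Pk" "a \<in> A"
  shows "infdist a B \<le> hausdorff_dist A B"
proof -
  have "infdist a B \<le> (SUP a\<in>A. infdist a B)"
    using assms by (intro cSUP_upper bdd_above_infdist) (auto simp: Pk_def)
  then show ?thesis
    using assms by (simp add: hausdorff_dist_infdist Pk_def)
qed

lemma hausdorff_dist_commute: "hausdorff_dist A B = hausdorff_dist B A"
  by (simp add: hausdorff_dist_def norm_minus_commute max.commute)

lemma hausdorff_dist_leI:
  assumes "A \<in> Pk" "B \<in> Pk"
    and "\<And>a. a \<in> A \<Longrightarrow> infdist a B \<le> r" "\<And>b. b \<in> B \<Longrightarrow> infdist b A \<le> r"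
  shows "hausdorff_dist A B \<le> r"
  using assms by (auto simp: hausdorff_dist_infdist Pk_def intro!: cSUP_least)

lemma hausdorff_dist_nonneg:
  assumes "A \<in> Pk" "B \<in> Pk"
  shows "0 \<le> hausdorff_dist A B"
proof -
  obtain a where "a \<in> A" using assms by (auto simp: Pk_def)
  then show ?thesis
    using infdist_le_hausdorff_dist[OF assms] infdist_nonneg order_trans by blast
qed

lemma hausdorff_dist_eq_0D:
  assumes "A \<in> Pk" "B \<in> Pk" "hausdorff_dist A B = 0"
  shows "A \<subseteq> B"
proof
  fix a assume "a \<in> A"
  then have "infdist a B = 0"
    using infdist_le_hausdorff_dist[OF assms(1,2)] assms(3) infdist_nonneg
    by (metis order_antisym)
  then show "a \<in> B"
    using assms(2) in_closed_iff_infdist_zero[of B a] by (auto simp: Pk_def compact_imp_closed)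
qed

lemma infdist_triangle_hausdorff_dist:
  assumes "A \<in> Pk" "B \<in> Pk" "C \<in> Pk" "a \<in> A"
  shows "infdist a C \<le> hausdorff_dist A B + hausdorff_dist B C"
proof -
  have ne: "B \<noteq> {}" and cpt: "compact B"
    using assms(2) by (auto simp: Pk_def)
  have "continuous_on B (dist a)"
    by (intro continuous_intros)
  then obtain b where b: "b \<in> B" "\<And>y. y \<in> B \<Longrightarrow> dist a b \<le> dist a y"
    using continuous_attains_inf[OF cpt ne] by blast
  then have "dist a b \<le> infdist a B"
    using ne by (simp add: infdist_notempty cINF_greatest)
  have "infdist a C \<le> infdist b C + dist a b"
    by (rule infdist_triangle)
  also have "\<dots> \<le> hausdorff_dist B C + hausdorff_dist A B"
    using infdist_le_hausdorff_dist[OF assms(2,3) b(1)]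
      infdist_le_hausdorff_dist[OF assms(1,2,4)] \<open>dist a b \<le> infdist a B\<close> by simp
  finally show ?thesis by simp
qed

lemma Metric_space_Pk_dist: "Metric_space Pk Pk_dist"
proof (unfold Metric_space_def, intro conjI allI impI)
  fix A B :: "'a set"
  show "0 \<le> Pk_dist A B"
    by (simp add: Pk_dist_def hausdorff_dist_nonneg)
  show "Pk_dist A B = Pk_dist B A"
    by (simp add: Pk_dist_def hausdorff_dist_commute)
next
  fix A B :: "'a set"
  assume AB: "A \<in> Pk" "B \<in> Pk"
  have "A = B" if "hausdorff_dist A B = 0"
    using hausdorff_dist_eq_0D[OF AB that] hausdorff_dist_eq_0D[OF AB(2,1)] that
    by (auto simp: hausdorff_dist_commute)
  moreover have "hausdorff_dist A A = 0"
    using AB hausdorff_dist_nonneg[of A A] hausdorff_dist_leI[of A A 0] by force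
  ultimately show "(Pk_dist A B = 0) = (A = B)"
    using AB by (auto simp: Pk_dist_def)
next
  fix A B C :: "'a set"
  assume A: "A \<in> Pk" and B: "B \<in> Pk" and C: "C \<in> Pk"
  have "hausdorff_dist A C \<le> hausdorff_dist A B + hausdorff_dist B C"
  proof (rule hausdorff_dist_leI[OF A C])
    show "infdist a C \<le> hausdorff_dist A B + hausdorff_dist B C" if "a \<in> A" for a
      using infdist_triangle_hausdorff_dist[OF A B C that] .
    show "infdist c A \<le> hausdorff_dist A B + hausdorff_dist B C" if "c \<in> C" for c
      using infdist_triangle_hausdorff_dist[OF C B A that]
      by (simp add: hausdorff_dist_commute)
  qed
  then show "Pk_dist A C \<le> Pk_dist A B + Pk_dist B C"
    using A B C by (simp add: Pk_dist_def)
qed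

lemma set_norm_eq:
  assumes "A \<in> Pk"
  shows "set_norm A = (SUP a\<in>A. norm a)"
proof -
  have ne: "A \<noteq> {}" and bdd: "bdd_above (norm ` A)"
    using assms by (auto simp: Pk_def bdd_above_norm compact_imp_bounded)
  obtain a where a: "a \<in> A" using ne by blast
  have "infdist 0 A \<le> norm a" using infdist_le[OF a, of 0] by simp
  also have "\<dots> \<le> (SUP a\<in>A. norm a)" by (rule cSUP_upper[OF a bdd])
  finally show ?thesis
    using ne by (simp add: set_norm_def hausdorff_dist_infdist)
qed

end

theory Submission
  imports Defs "HOL-Library.Discrete_Functions"
begin

text \<open>For a fixed functional \<open>x\<close>, the support functions \<open>\<sigma>(x, V\<^sub>k)\<close> are uncorrelated with bounded
  variances, so they satisfy the strong law (second moments along the squares, with the gaps between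
  squares controlled by second moments as well). The support function of a Minkowski sum is the sum of
  the support functions, and the support function of the Aumann integral is the expectation of the
  support function, so almost surely the support functions of both averages have the same limit
  behaviour on a countable dense set of functionals. Uniform integrability bounds the averaged
  expectations, so the support functions are equi-Lipschitz and the convergence is uniform on the
  compact dual unit ball of the finite-dimensional space, which is Hausdorff convergence.\<close>

section \<open>Support functions\<close>

text \<open>The null set of the strong law depends on the functional, so almost sure convergence is
  available for countably many functionals at once; the passage to sets is then a deterministic
  argument at a fixed \<open>\<omega>\<close>. With variances bounded by \<open>C\<close>, the mean
  over n terms has variance of order 1/n, which is not summable; along squares the order is 1/n^2.
  Of the Aumann expectations only nonemptiness, boundedness and convexity are established, not
  closedness, which is why support functions are developed for bounded sets and nearest points are
  taken up to an error. In place of the dual unit ball stands the cube of combinations of finitely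
  many coordinate functionals with coefficients in [-1, 1], and grids of rational coefficients serve
  as finite nets.\<close>

lemma bdd_above_blinfun_image:
  fixes x :: "'a::real_normed_vector \<Rightarrow>\<^sub>L real"
  assumes "bounded A"
  shows "bdd_above (blinfun_apply x ` A)"
  using assms by (intro bounded_imp_bdd_above bounded_linear_image blinfun.bounded_linear_right)

lemma le_support_fun:
  assumes "bounded A" "a \<in> A"
  shows "blinfun_apply x a \<le> support_fun x A"
  unfolding support_fun_def using assms by (intro cSUP_upper bdd_above_blinfun_image)

lemma support_fun_le:
  assumes "A \<noteq> {}" "\<And>a. a \<in> A \<Longrightarrow> blinfun_apply x a \<le> r"
  shows "support_fun x A \<le> r"
  unfolding support_fun_def using assms by (intro cSUP_least)

lemma less_support_fun_iff:
  assumes "A \<noteq> {}" "bounded A"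
  shows "r < support_fun x A \<longleftrightarrow> (\<exists>a\<in>A. r < blinfun_apply x a)"
  unfolding support_fun_def using assms by (intro less_cSUP_iff bdd_above_blinfun_image)

lemma support_fun_set_plus:
  assumes "A \<noteq> {}" "bounded A" "B \<noteq> {}" "bounded B"
  shows "support_fun x (A + B) = support_fun x A + support_fun x B"
proof (rule antisym)
  show "support_fun x (A + B) \<le> support_fun x A + support_fun x B"
    using assms
    by (intro support_fun_le) (auto simp: set_plus_def blinfun.add_right intro!: add_mono le_support_fun)
  have "bounded (A + B)"
    using bounded_plus[OF assms(2,4)] by (simp add: set_plus_image)
  then have le: "blinfun_apply x a + blinfun_apply x b \<le> support_fun x (A + B)"
    if "a \<in> A" "b \<in> B" for a b
    using le_support_fun[of "A + B" "a + b" x] that by (auto simp: blinfun.add_right)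
  have "support_fun x A \<le> support_fun x (A + B) - blinfun_apply x b" if "b \<in> B" for b
    using le that assms(1) by (intro support_fun_le) (auto simp: algebra_simps)
  then have "support_fun x B \<le> support_fun x (A + B) - support_fun x A"
    using assms(3) by (intro support_fun_le) (auto simp: algebra_simps)
  then show "support_fun x A + support_fun x B \<le> support_fun x (A + B)" by simp
qed

lemma support_fun_scaled_set:
  assumes "A \<noteq> {}" "bounded A" "0 \<le> c"
  shows "support_fun x ((*\<^sub>R) c ` A) = c * support_fun x A"
proof (cases "c = 0")
  \<comment> \<open>At \<open>n = 0\<close> the factor \<open>1 / real n\<close> is 0 and the
    average collapses to \<open>{0}\<close>, so this case does occur.\<close>
  case True
  have "(*\<^sub>R) 0 ` A = {0}" using assms(1) by auto
  then show ?thesis using True by (simp add: support_fun_def blinfun.zero_right)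
next
  case False
  then have c: "c > 0" using assms by simp
  show ?thesis
  proof (rule antisym)
    show "support_fun x ((*\<^sub>R) c ` A) \<le> c * support_fun x A"
      using assms
      by (intro support_fun_le) (auto simp: blinfun.scaleR_right intro!: mult_left_mono le_support_fun)
    have "bounded ((*\<^sub>R) c ` A)" using assms(2) by (rule bounded_scaling)
    then have "c * blinfun_apply x a \<le> support_fun x ((*\<^sub>R) c ` A)" if "a \<in> A" for a
      using le_support_fun[of "(*\<^sub>R) c ` A" "c *\<^sub>R a" x] that by (auto simp: blinfun.scaleR_right)
    then have "support_fun x A \<le> support_fun x ((*\<^sub>R) c ` A) / c"
      using assms(1) c by (intro support_fun_le) (auto simp: field_simps)
    then show "c * support_fun x A \<le> support_fun x ((*\<^sub>R) c ` A)"
      using c by (simp add: field_simps)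
  qed
qed

lemma support_fun_scaled_functional:
  assumes "A \<noteq> {}" "bounded A" "0 \<le> c"
  shows "support_fun (c *\<^sub>R x) A = c * support_fun x A"
proof -
  have "support_fun (c *\<^sub>R x) A = support_fun x ((*\<^sub>R) c ` A)"
    by (simp add: support_fun_def image_image blinfun.scaleR_left blinfun.scaleR_right)
  then show ?thesis using support_fun_scaled_set[OF assms] by simp
qed

lemma support_fun_zero: "A \<noteq> {} \<Longrightarrow> support_fun 0 A = 0"
  by (simp add: support_fun_def)

text \<open>Replacing \<open>x\<close> by \<open>y\<close> costs at most
  \<open>norm (x - y) * R\<close> at each point of \<open>A\<close>. The Lipschitz constant depends
  on the radius alone, so uniformly bounded sets have equi-Lipschitz support functions.\<close>

lemma abs_support_fun_diff_le:
  fixes x y :: "'a::real_normed_vector \<Rightarrow>\<^sub>L real"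
  assumes "A \<noteq> {}" "\<And>a. a \<in> A \<Longrightarrow> norm a \<le> R"
  shows "\<bar>support_fun x A - support_fun y A\<bar> \<le> norm (x - y) * R"
proof -
  have bd: "bounded A" using assms(2) boundedI by blast
  have *: "support_fun x A \<le> support_fun y A + norm (x - y) * R"
    for x y :: "'a \<Rightarrow>\<^sub>L real"
  proof (rule support_fun_le[OF assms(1)])
    fix a assume a: "a \<in> A"
    have "blinfun_apply x a = blinfun_apply y a + blinfun_apply (x - y) a"
      by (simp add: blinfun.diff_left)
    also have "blinfun_apply (x - y) a \<le> norm (x - y) * norm a"
      using norm_blinfun[of "x - y" a] by simp
    also have "\<dots> \<le> norm (x - y) * R"
      using assms(2)[OF a] by (intro mult_left_mono) auto
    also have "blinfun_apply y a \<le> support_fun y A"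
      using le_support_fun[OF bd a] .
    finally show "blinfun_apply x a \<le> support_fun y A + norm (x - y) * R" by simp
  qed
  show ?thesis using *[of x y] *[of y x] by (simp add: norm_minus_commute abs_le_iff)
qed

lemma abs_support_fun_le:
  assumes "A \<noteq> {}" "\<And>a. a \<in> A \<Longrightarrow> norm a \<le> R"
  shows "\<bar>support_fun x A\<bar> \<le> norm x * R"
  using abs_support_fun_diff_le[OF assms, of x 0] assms(1) by (simp add: support_fun_zero)

lemma set_sum_nonempty_bounded:
  fixes A :: "'i \<Rightarrow> 'a::real_normed_vector set"
  assumes "\<And>i. i \<in> I \<Longrightarrow> A i \<noteq> {} \<and> bounded (A i)"
  shows "(\<Sum>i\<in>I. A i) \<noteq> {} \<and> bounded (\<Sum>i\<in>I. A i)"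
  using assms
proof (induction I rule: infinite_finite_induct)
  case (insert i I)
  then have "A i \<noteq> {}" "bounded (A i)" "sum A I \<noteq> {}" "bounded (sum A I)" by auto
  then show ?case
    using insert(1,2) bounded_plus[of "A i" "sum A I"] by (auto simp: set_plus_image)
qed auto

lemma support_fun_set_sum:
  fixes A :: "'i \<Rightarrow> 'a::real_normed_vector set"
  assumes "\<And>i. i \<in> I \<Longrightarrow> A i \<noteq> {} \<and> bounded (A i)"
  shows "support_fun x (\<Sum>i\<in>I. A i) = (\<Sum>i\<in>I. support_fun x (A i))"
  using assms
proof (induction I rule: infinite_finite_induct)
  case (insert i I)
  then show ?case
    using set_sum_nonempty_bounded[of I A] by (simp add: support_fun_set_plus)
\<comment> \<open>For an empty or infinite index set the sum is the set \<open>{0}\<close>.\<close>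
qed (auto simp: support_fun_def blinfun.zero_right)

lemma norm_le_in_set_sum:
  fixes A :: "'i \<Rightarrow> 'a::real_normed_vector set"
  assumes "\<And>i a. i \<in> I \<Longrightarrow> a \<in> A i \<Longrightarrow> norm a \<le> R i" "finite I" "a \<in> (\<Sum>i\<in>I. A i)"
  shows "norm a \<le> (\<Sum>i\<in>I. R i)"
proof -
  obtain s where "a = sum s I" "\<forall>i\<in>I. s i \<in> A i"
    using assms(3) set_sum_alt[OF assms(2), of A] by auto
  then show ?thesis using assms(1) by (auto intro!: sum_norm_le)
qed


section \<open>Coordinate functionals and Hausdorff convergence\<close>

text \<open>Equivalence of norms: the norm of the combination attains its minimum over the compact
  l1 unit sphere of coefficients; independence makes the minimum positive, and homogeneity extends
  the bound.\<close>

lemma norm_linear_combination_lower_bound: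
  fixes B :: "'a::real_normed_vector set"
  assumes "finite B" "independent B"
  obtains m where "m > 0" "\<And>c. m * (\<Sum>b\<in>B. \<bar>c b\<bar>) \<le> norm (\<Sum>b\<in>B. c b *\<^sub>R b)"
proof (cases "B = {}")
  case True
  then show ?thesis using that[of 1] by simp
next
  case False
  \<comment> \<open>Coefficients are functions on the whole type; pinning them to 0 off
    \<open>B\<close> makes the box compact in the product topology.\<close>
  define P where "P = (\<Pi>\<^sub>E b\<in>UNIV. if b \<in> B then {-1..1::real} else {0})"
  define S where "S = P \<inter> {c. (\<Sum>b\<in>B. \<bar>c b\<bar>) = 1}"
  define f where "f c = norm (\<Sum>b\<in>B. c b *\<^sub>R b)" for c :: "'a \<Rightarrow> real"
  have "compact P"
    unfolding P_def euclidean_product_topology[symmetric] compactin_euclidean_iff[symmetric]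
    by (subst compactin_PiE) (auto simp: compactin_euclidean_iff)
  moreover have "closed {c::'a \<Rightarrow> real. (\<Sum>b\<in>B. \<bar>c b\<bar>) = 1}"
    by (intro closed_Collect_eq continuous_intros continuous_on_product_coordinates)
  ultimately have "compact S" unfolding S_def by (rule compact_Int_closed)
  have in_S: "(\<lambda>b. if b \<in> B then c b / (\<Sum>b\<in>B. \<bar>c b\<bar>) else 0) \<in> S"
    if "(\<Sum>b\<in>B. \<bar>c b\<bar>) > 0" for c
  proof -
    have "\<bar>c b\<bar> \<le> (\<Sum>b\<in>B. \<bar>c b\<bar>)" if "b \<in> B" for b
      using assms(1) that by (intro member_le_sum) auto
    then have "\<bar>c b / (\<Sum>b\<in>B. \<bar>c b\<bar>)\<bar> \<le> 1" if "b \<in> B" for b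
      using that \<open>(\<Sum>b\<in>B. \<bar>c b\<bar>) > 0\<close> by simp
    then have "(\<lambda>b. if b \<in> B then c b / (\<Sum>b\<in>B. \<bar>c b\<bar>) else 0) \<in> P"
      unfolding P_def abs_le_iff by (auto simp: PiE_iff minus_le_iff simp del: divide_le_eq_1)
    moreover have "(\<Sum>b\<in>B. \<bar>c b / (\<Sum>b\<in>B. \<bar>c b\<bar>)\<bar>) = 1"
      using that by (simp flip: sum_divide_distrib)
    ultimately show ?thesis
      by (simp add: S_def cong: sum.cong)
  qed
  have "S \<noteq> {}"
    using in_S[of "\<lambda>_. 1"] False assms(1) by (auto simp: card_gt_0_iff)
  moreover have "continuous_on S f"
    unfolding f_def
    by (intro continuous_intros continuous_on_subset[OF continuous_on_product_coordinates]) auto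
  ultimately obtain c0 where c0: "c0 \<in> S" "\<And>c. c \<in> S \<Longrightarrow> f c0 \<le> f c"
    using continuous_attains_inf[OF \<open>compact S\<close>] by blast
  have "f c0 \<noteq> 0"
  proof
    assume "f c0 = 0"
    then have "\<forall>b\<in>B. c0 b = 0"
      using independentD[OF assms(2,1) order_refl, of c0] unfolding f_def by simp
    then have "(\<Sum>b\<in>B. \<bar>c0 b\<bar>) = 0" by simp
    then show False using c0(1) by (simp add: S_def)
  qed
  then have pos: "f c0 > 0" by (simp add: f_def)
  show ?thesis
  proof (rule that[OF pos])
    fix c :: "'a \<Rightarrow> real"
    let ?s = "\<Sum>b\<in>B. \<bar>c b\<bar>"
    show "f c0 * ?s \<le> norm (\<Sum>b\<in>B. c b *\<^sub>R b)"
    proof (cases "?s > 0")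
      case True
      have "f c0 \<le> f (\<lambda>b. if b \<in> B then c b / ?s else 0)"
        using c0(2) in_S[OF True] by blast
      also have "\<dots> = norm ((1 / ?s) *\<^sub>R (\<Sum>b\<in>B. c b *\<^sub>R b))"
        unfolding f_def by (simp add: scaleR_sum_right cong: sum.cong)
      also have "\<dots> = norm (\<Sum>b\<in>B. c b *\<^sub>R b) / ?s"
        using True by simp
      finally show ?thesis using True by (simp add: field_simps)
    next
      case False
      moreover have "?s \<ge> 0" by (intro sum_nonneg) auto
      ultimately have "?s = 0" by linarith
      then show ?thesis by simp
    qed
  qed
qed

text \<open>A basis \<open>I\<close> is extracted from the spanning set; \<open>\<phi> i\<close> is
  the \<open>i\<close>-th coordinate, bounded with constant \<open>1 / m\<close> by the preceding
  norm equivalence.\<close>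

lemma finite_dim_coordinate_functionals:
  fixes B :: "'a::real_normed_vector set"
  assumes "finite B" "span B = UNIV"
  obtains I :: "'a set" and \<phi> :: "'a \<Rightarrow> 'a \<Rightarrow>\<^sub>L real" and c
  where "finite I" "\<And>y. norm y \<le> c * (\<Sum>i\<in>I. \<bar>\<phi> i y\<bar>)" "0 < c"
proof -
  obtain I where I: "I \<subseteq> B" "independent I" "B \<subseteq> span I"
    using maximal_independent_subset[of B] by blast
  have fin: "finite I" using I(1) assms(1) finite_subset by blast
  have sp: "span I = UNIV"
    using span_mono[OF I(3)] assms(2) by (simp add: span_span top.extremum_unique)
  obtain m where m: "m > 0" "\<And>c. m * (\<Sum>b\<in>I. \<bar>c b\<bar>) \<le> norm (\<Sum>b\<in>I. c b *\<^sub>R b)"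
    using norm_linear_combination_lower_bound[OF fin I(2)] by blast
  let ?r = "\<lambda>i y. representation I y i"
  have expand: "(\<Sum>b\<in>I. ?r b y *\<^sub>R b) = y" for y
    using sum_representation_eq[OF I(2), of y I] fin sp by simp
  have bl: "bounded_linear (?r i)" for i
  proof (rule bounded_linear_intro[where K = "1/m"])
    fix x y :: 'a and t :: real
    show "?r i (x + y) = ?r i x + ?r i y"
      using representation_add[OF I(2)] sp by simp
    show "?r i (t *\<^sub>R x) = t *\<^sub>R ?r i x"
      using representation_scale[OF I(2)] sp by simp
    have "\<bar>?r i x\<bar> \<le> (\<Sum>b\<in>I. \<bar>?r b x\<bar>)"
    proof (cases "i \<in> I")
      case True
      then show ?thesis using fin by (intro member_le_sum) auto
    next
      case False
      then have "?r i x = 0" using representation_ne_zero by blast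
      then show ?thesis by (simp add: sum_nonneg)
    qed
    then have "m * \<bar>?r i x\<bar> \<le> norm x"
      using m(2)[of "\<lambda>b. ?r b x"] m(1) by (simp add: expand) (meson mult_left_mono less_imp_le order_trans)
    then show "norm (?r i x) \<le> norm x * (1 / m)" using m(1) by (simp add: field_simps)
  qed
  \<comment> \<open>The summand 1 keeps \<open>c\<close> positive in the zero space, where
    \<open>I\<close> is empty.\<close>
  define c where "c = 1 + (\<Sum>b\<in>I. norm b)"
  have c: "c > 0" "\<And>b. b \<in> I \<Longrightarrow> norm b \<le> c"
    using fin member_le_sum[of _ I norm] sum_nonneg[of I norm] by (force simp: c_def)+
  show ?thesis
  proof (rule that[OF fin _ c(1)])
    fix y :: 'a
    have "norm y = norm (\<Sum>b\<in>I. ?r b y *\<^sub>R b)" by (simp add: expand)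
    also have "\<dots> \<le> (\<Sum>b\<in>I. \<bar>?r b y\<bar> * c)"
      using c by (intro sum_norm_le) (auto intro!: mult_left_mono)
    finally show "norm y \<le> c * (\<Sum>i\<in>I. \<bar>blinfun_apply (Blinfun (?r i)) y\<bar>)"
      by (simp add: bounded_linear_Blinfun_apply[OF bl] sum_distrib_left mult.commute)
  qed
qed

text \<open>The separating functional is taken in the direction from an approximately nearest point of
  \<^term>\<open>B\<close> with respect to the Euclidean norm given by the coordinates \<^term>\<open>\<phi>\<close>; this replaces
  the Hahn--Banach theorem at the cost of a constant factor.\<close>

lemma infdist_le_support_gap:
  fixes \<phi> :: "'i \<Rightarrow> 'a::real_normed_vector \<Rightarrow>\<^sub>L real"
  assumes I: "finite I" and c: "\<And>y. norm y \<le> c * (\<Sum>i\<in>I. \<bar>\<phi> i y\<bar>)" "0 < c"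
    and B: "convex B" "bounded B" "B \<noteq> {}" and r: "0 \<le> r"
    and gap: "\<And>u. (\<And>i. i \<in> I \<Longrightarrow> \<bar>u i\<bar> \<le> 1) \<Longrightarrow>
      blinfun_apply (\<Sum>i\<in>I. u i *\<^sub>R \<phi> i) a \<le> support_fun (\<Sum>i\<in>I. u i *\<^sub>R \<phi> i) B + r"
  shows "infdist a B \<le> c * real (card I) * r"
proof (rule ccontr)
  define m where "m = real (card I)"
  define d where "d = infdist a B"
  \<comment> \<open>Squared Euclidean length of \<open>a - b\<close> in the coordinates: being
    quadratic along segments, it yields a first-order condition at an approximate minimiser.\<close>
  define Q where "Q b = (\<Sum>i\<in>I. (\<phi> i (a - b))\<^sup>2)" for b
  assume "\<not> infdist a B \<le> c * real (card I) * r"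
  then have d: "d > c * m * r" by (simp add: d_def m_def)
  have m: "m \<ge> 0" by (simp add: m_def)
  have dpos: "d > 0" using d m r c(2) by (smt (verit) mult_nonneg_nonneg)
  obtain R where R: "\<And>b. b \<in> B \<Longrightarrow> norm b \<le> R" "0 < R"
    using B(2) bounded_pos by metis
  define D where "D = (\<Sum>i\<in>I. (norm (\<phi> i) * (2 * R))\<^sup>2)"
  have D: "D \<ge> 0" unfolding D_def by (intro sum_nonneg) auto
  have diam: "(\<Sum>i\<in>I. (\<phi> i (b - p))\<^sup>2) \<le> D" if "b \<in> B" "p \<in> B" for b p
    unfolding D_def
  proof (rule sum_mono)
    fix i assume "i \<in> I"
    have "\<bar>\<phi> i (b - p)\<bar> \<le> norm (\<phi> i) * norm (b - p)" using norm_blinfun[of "\<phi> i"] by simp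
    also have "\<dots> \<le> norm (\<phi> i) * (2 * R)"
      using R(1)[OF that(1)] R(1)[OF that(2)] norm_triangle_ineq4[of b p]
      by (intro mult_left_mono) auto
    finally show "(\<phi> i (b - p))\<^sup>2 \<le> (norm (\<phi> i) * (2 * R))\<^sup>2"
      by (metis abs_ge_zero power2_abs power_mono)
  qed
  \<comment> \<open>The value of \<open>t * (t - m * r)\<close> at \<open>t = d / c\<close>, hence a
    lower bound for it at the later \<open>s\<close>, since \<open>s \<ge> d / c > m * r\<close>.
    The contradiction comes from the upper bound \<open>m * (\<epsilon> * (1 + D) / 2)\<close> for
    the same quantity, which \<open>\<epsilon>\<close> is chosen to push below
    \<open>\<kappa>\<close>.\<close>
  define \<kappa> where "\<kappa> = (d / c) * (d / c - m * r)"
  have \<kappa>: "\<kappa> > 0"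
    unfolding \<kappa>_def using d dpos c(2) by (intro mult_pos_pos) (auto simp: field_simps)
  \<comment> \<open>The cap 1 makes \<open>\<epsilon>\<close> a convex weight; the added 1 in the
    denominator covers \<open>m = 0\<close>.\<close>
  define \<epsilon> where "\<epsilon> = min 1 (\<kappa> / (m * (1 + D) + 1))"
  have den: "m * (1 + D) + 1 > 0" using m D by (simp add: add_nonneg_pos)
  have \<epsilon>: "0 < \<epsilon>" "\<epsilon> \<le> 1" using \<kappa> den by (auto simp: \<epsilon>_def)
  have "\<epsilon> * (m * (1 + D) + 1) \<le> \<kappa>"
    using den by (simp add: \<epsilon>_def flip: pos_le_divide_eq)
  then have \<epsilon>\<kappa>: "m * (\<epsilon> * (1 + D) / 2) < \<kappa>"
    using \<epsilon>(1) m D by (simp add: field_simps) (smt (verit) mult_nonneg_nonneg)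
  have "bdd_below (Q ` B)"
    by (intro bdd_belowI[of _ 0]) (auto simp: Q_def intro!: sum_nonneg)
  then have Inf_le: "(INF b\<in>B. Q b) \<le> Q b" if "b \<in> B" for b using that by (rule cINF_lower)
  \<comment> \<open>The infimum may not be attained, so \<open>Q\<close> is minimised up to
    \<open>\<epsilon>\<^sup>2\<close>, an error that survives division by the step length
    \<open>\<epsilon>\<close>.\<close>
  obtain p where p: "p \<in> B" "Q p < (INF b\<in>B. Q b) + \<epsilon>\<^sup>2"
    using cINF_less_iff[OF B(3) \<open>bdd_below _\<close>, of "(INF b\<in>B. Q b) + \<epsilon>\<^sup>2"] \<epsilon>(1) by auto
  define w where "w i = \<phi> i (a - p)" for i
  define s where "s = (\<Sum>i\<in>I. \<bar>w i\<bar>)"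
  have "d \<le> norm (a - p)"
    using infdist_le[OF p(1), of a] by (simp add: d_def dist_norm)
  also have "\<dots> \<le> c * s" using c(1)[of "a - p"] by (simp add: s_def w_def)
  finally have s: "d / c \<le> s" using c(2) by (simp add: field_simps)
  have spos: "s > 0" using s dpos c(2) by (smt (verit) divide_pos_pos)
  \<comment> \<open>Variational inequality at \<open>p\<close>: compare \<open>Q p\<close> with the
    value of \<open>Q\<close> at the fraction \<open>\<epsilon>\<close> of the segment towards
    \<open>b\<close>, expand the squares and divide by \<open>2 * \<epsilon>\<close>.\<close>
  have acute: "(\<Sum>i\<in>I. w i * \<phi> i (b - p)) \<le> \<epsilon> * (1 + D) / 2" if b: "b \<in> B" for b
  proof -
    let ?v = "\<lambda>i. \<phi> i (b - p)"
    have "(1 - \<epsilon>) *\<^sub>R p + \<epsilon> *\<^sub>R b \<in> B"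
      using B(1) p(1) b \<epsilon> by (auto simp: convex_alt)
    from Inf_le[OF this] p(2) have "Q p - \<epsilon>\<^sup>2 \<le> Q ((1 - \<epsilon>) *\<^sub>R p + \<epsilon> *\<^sub>R b)" by simp
    also have "\<dots> = (\<Sum>i\<in>I. (w i - \<epsilon> * ?v i)\<^sup>2)"
      unfolding Q_def w_def
      by (intro sum.cong refl)
        (simp add: blinfun.diff_right blinfun.add_right blinfun.scaleR_right algebra_simps)
    also have "\<dots> = Q p - 2 * \<epsilon> * (\<Sum>i\<in>I. w i * ?v i) + \<epsilon>\<^sup>2 * (\<Sum>i\<in>I. (?v i)\<^sup>2)"
      unfolding Q_def w_def[symmetric]
      by (simp add: power2_diff sum.distrib sum_subtractf sum_distrib_left power_mult_distrib algebra_simps)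
    finally have "2 * \<epsilon> * (\<Sum>i\<in>I. w i * ?v i) \<le> \<epsilon>\<^sup>2 + \<epsilon>\<^sup>2 * (\<Sum>i\<in>I. (?v i)\<^sup>2)" by simp
    also have "\<dots> \<le> \<epsilon>\<^sup>2 + \<epsilon>\<^sup>2 * D"
      using diam[OF b p(1)] by (intro add_left_mono mult_left_mono) auto
    also have "\<dots> = 2 * \<epsilon> * (\<epsilon> * (1 + D) / 2)" by (simp add: power2_eq_square algebra_simps)
    finally show ?thesis using \<epsilon>(1) by simp
  qed
  \<comment> \<open>The functional in the direction of \<open>a - p\<close>; division by
    \<open>s\<close>, the l1 norm of \<open>w\<close>, puts its coefficients into [-1, 1], as
    \<open>gap\<close> requires.\<close>
  let ?\<psi> = "\<Sum>i\<in>I. (w i / s) *\<^sub>R \<phi> i"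
  have \<psi>: "blinfun_apply ?\<psi> y = (\<Sum>i\<in>I. w i * \<phi> i y) / s" for y
    by (simp add: blinfun.sum_left blinfun.scaleR_left sum_divide_distrib)
  have "support_fun ?\<psi> B \<le> blinfun_apply ?\<psi> a - (Q p - \<epsilon> * (1 + D) / 2) / s"
  proof (rule support_fun_le[OF B(3)])
    fix b assume b: "b \<in> B"
    have "(\<Sum>i\<in>I. w i * \<phi> i a) - (\<Sum>i\<in>I. w i * \<phi> i b) = Q p - (\<Sum>i\<in>I. w i * \<phi> i (b - p))"
      unfolding Q_def w_def
      by (simp add: blinfun.diff_right power2_eq_square algebra_simps flip: sum.distrib sum_subtractf)
    then have "(\<Sum>i\<in>I. w i * \<phi> i b) \<le> (\<Sum>i\<in>I. w i * \<phi> i a) - (Q p - \<epsilon> * (1 + D) / 2)"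
      using acute[OF b] by simp
    then show "blinfun_apply ?\<psi> b \<le> blinfun_apply ?\<psi> a - (Q p - \<epsilon> * (1 + D) / 2) / s"
      unfolding \<psi> diff_divide_distrib[symmetric] using spos by (intro divide_right_mono) auto
  qed
  moreover have "\<bar>w i / s\<bar> \<le> 1" if "i \<in> I" for i
    using member_le_sum[of i I "\<lambda>i. \<bar>w i\<bar>"] that I spos by (simp add: s_def)
  ultimately have "(Q p - \<epsilon> * (1 + D) / 2) / s \<le> r"
    using gap[of "\<lambda>i. w i / s"] by simp
  then have "Q p \<le> r * s + \<epsilon> * (1 + D) / 2" using spos by (simp add: field_simps)
  then have "m * Q p \<le> m * (r * s + \<epsilon> * (1 + D) / 2)" using m by (rule mult_left_mono)
  \<comment> \<open>Cauchy-Schwarz between the l1 and l2 norms of the coordinates; this is the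
    origin of the factor \<open>card I\<close>.\<close>
  moreover have "s\<^sup>2 \<le> m * Q p"
    using sum_squared_le_sum_of_squares[of "\<lambda>i. \<bar>w i\<bar>" I]
    by (simp add: s_def Q_def w_def m_def mult.commute)
  moreover have "s * (s - m * r) = s\<^sup>2 - m * (r * s)"
    by (simp add: power2_eq_square algebra_simps)
  ultimately have "s * (s - m * r) \<le> m * (\<epsilon> * (1 + D) / 2)"
    by (simp only: distrib_left)
  moreover have "\<kappa> \<le> s * (s - m * r)"
    unfolding \<kappa>_def using s d dpos spos c(2) by (intro mult_mono) (auto simp: field_simps)
  ultimately show False using \<epsilon>\<kappa> by simp
qed

text \<open>Compactness is not at hand for averaged expectations: the pointwise bound
  \<open>r\<close> itself supplies the boundedness that suprema of reals require, and one point of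
  \<open>A\<close> makes the distance nonnegative.\<close>

lemma abs_hausdorff_dist_le:
  assumes "A \<noteq> {}" "B \<noteq> {}"
    and "\<And>a. a \<in> A \<Longrightarrow> infdist a B \<le> r" "\<And>b. b \<in> B \<Longrightarrow> infdist b A \<le> r"
  shows "\<bar>hausdorff_dist A B\<bar> \<le> r"
proof -
  obtain a where a: "a \<in> A" using assms(1) by blast
  have "bdd_above ((\<lambda>a. infdist a B) ` A)" using assms(3) by (intro bdd_aboveI2)
  then have "infdist a B \<le> (SUP a\<in>A. infdist a B)" by (rule cSUP_upper[OF a])
  then have "0 \<le> (SUP a\<in>A. infdist a B)" using infdist_nonneg order_trans by blast
  moreover have "(SUP a\<in>A. infdist a B) \<le> r" "(SUP b\<in>B. infdist b A) \<le> r"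
    using assms by (auto intro!: cSUP_least)
  ultimately show ?thesis using assms by (simp add: hausdorff_dist_infdist)
qed

text \<open>Pointwise convergence of the support functions on the countable set of rational combinations
  of coordinate functionals is uniform on the bounded ones, because one of the two sequences, and
  hence the other, is uniformly bounded.\<close>

lemma hausdorff_dist_tendsto_0:
  fixes \<phi> :: "'i \<Rightarrow> 'a::real_normed_vector \<Rightarrow>\<^sub>L real"
  assumes I: "finite I" and c: "\<And>y. norm y \<le> c * (\<Sum>i\<in>I. \<bar>\<phi> i y\<bar>)" "0 < c"
    and A: "\<And>n. convex (A n)" "\<And>n. bounded (A n)" "\<And>n. A n \<noteq> {}"
    and B: "\<And>n. convex (B n)" "\<And>n b. b \<in> B n \<Longrightarrow> norm b \<le> R" "\<And>n. B n \<noteq> {}"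
    and lim: "\<And>q. (\<And>i. i \<in> I \<Longrightarrow> q i \<in> \<rat>) \<Longrightarrow>
      (\<lambda>n. support_fun (\<Sum>i\<in>I. q i *\<^sub>R \<phi> i) (A n) - support_fun (\<Sum>i\<in>I. q i *\<^sub>R \<phi> i) (B n))
        \<longlonglongrightarrow> 0"
  shows "(\<lambda>n. hausdorff_dist (A n) (B n)) \<longlonglongrightarrow> 0"
proof -
  define h where "h = (\<lambda>x n. support_fun x (A n) - support_fun x (B n))"
  define L where "L = (\<Sum>i\<in>I. norm (\<phi> i))"
  have bdB: "bounded (B n)" for n using B(2) boundedI by blast
  have "0 \<le> R" using B(2,3) norm_ge_zero order_trans by blast
  have L: "L \<ge> 0" "\<And>i. i \<in> I \<Longrightarrow> norm (\<phi> i) \<le> L"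
    using I by (auto simp: L_def intro!: sum_nonneg member_le_sum)
  have single: "h (t *\<^sub>R \<phi> i) \<longlonglongrightarrow> 0" if "i \<in> I" "t \<in> \<rat>" for i t
  proof -
    have "(\<Sum>j\<in>I. (if j = i then t else 0) *\<^sub>R \<phi> j) = (\<Sum>j\<in>I. if j = i then t *\<^sub>R \<phi> j else 0)"
      by (intro sum.cong) auto
    also have "\<dots> = t *\<^sub>R \<phi> i" using that(1) I by (simp add: sum.delta)
    finally show ?thesis
      using lim[of "\<lambda>j. if j = i then t else 0"] that(2) by (simp add: h_def)
  qed
  \<comment> \<open>Eventual bound for the sets \<open>A n\<close>: once \<open>h\<close> is below 1
    in modulus at \<open>\<phi> i\<close> and \<open>- \<phi> i\<close>, every coordinate is
    confined to modulus \<open>1 + L * R\<close>, and \<open>c\<close> converts coordinates into a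
    norm.\<close>
  define R' where "R' = c * (\<Sum>i\<in>I. 1 + L * R)"
  have "\<forall>\<^sub>F n in sequentially. \<forall>i\<in>I. \<bar>h (1 *\<^sub>R \<phi> i) n\<bar> < 1 \<and> \<bar>h ((-1) *\<^sub>R \<phi> i) n\<bar> < 1"
  proof (intro eventually_ball_finite I ballI eventually_conj)
    fix i assume "i \<in> I"
    then show "\<forall>\<^sub>F n in sequentially. \<bar>h (1 *\<^sub>R \<phi> i) n\<bar> < 1"
      "\<forall>\<^sub>F n in sequentially. \<bar>h ((-1) *\<^sub>R \<phi> i) n\<bar> < 1"
      using tendstoD[OF single, of i 1 1] tendstoD[OF single, of i "-1" 1]
      by (simp_all add: dist_real_def)
  qed
  then have R': "\<forall>\<^sub>F n in sequentially. \<forall>a\<in>A n. norm a \<le> R'"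
  proof (rule eventually_mono, intro ballI)
    fix n a assume h: "\<forall>i\<in>I. \<bar>h (1 *\<^sub>R \<phi> i) n\<bar> < 1 \<and> \<bar>h ((-1) *\<^sub>R \<phi> i) n\<bar> < 1" and a: "a \<in> A n"
    have *: "blinfun_apply x a \<le> 1 + norm x * R" if "\<bar>h x n\<bar> < 1" for x
      using le_support_fun[OF A(2) a, of x] abs_support_fun_le[OF B(3)[of n] B(2)[of _ n], of x] that
      by (simp add: h_def)
    have "\<bar>\<phi> i a\<bar> \<le> 1 + L * R" if i: "i \<in> I" for i
    proof -
      have "\<bar>\<phi> i a\<bar> \<le> 1 + norm (\<phi> i) * R"
        using *[of "\<phi> i"] *[of "- \<phi> i"] h i by (auto simp: blinfun.minus_left abs_le_iff)
      also have "\<dots> \<le> 1 + L * R" using L(2)[OF i] \<open>0 \<le> R\<close> by (simp add: mult_right_mono)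
      finally show ?thesis .
    qed
    then have "(\<Sum>i\<in>I. \<bar>\<phi> i a\<bar>) \<le> (\<Sum>i\<in>I. 1 + L * R)" by (rule sum_mono)
    then show "norm a \<le> R'"
      unfolding R'_def using c(1)[of a] c(2) by (meson mult_left_mono less_imp_le order_trans)
  qed
  have R'0: "0 \<le> R'" unfolding R'_def using c(2) L(1) \<open>0 \<le> R\<close> by (intro mult_nonneg_nonneg sum_nonneg) auto
  have key: "\<forall>\<^sub>F n in sequentially. \<bar>hausdorff_dist (A n) (B n)\<bar> \<le> c * real (card I) * \<epsilon>"
    if \<epsilon>: "\<epsilon> > 0" for \<epsilon>
  proof -
    \<comment> \<open>\<open>1 / N\<close> is the mesh of the coefficient grid: rounding moves a
      functional by at most \<open>L / N\<close>, hence \<open>h\<close> by at most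
      \<open>L * (R' + R) / N \<le> \<epsilon> / 2\<close>.\<close>
    obtain N :: nat where N: "2 * (L * (R' + R)) / \<epsilon> < real N" "N > 0"
      using reals_Archimedean2[of "max 0 (2 * (L * (R' + R)) / \<epsilon>)"] by force
    let ?x = "\<lambda>u. \<Sum>i\<in>I. u i *\<^sub>R \<phi> i"
    define G where "G = (\<lambda>k. ?x (\<lambda>i. of_int (k i) / real N)) ` (I \<rightarrow>\<^sub>E {- int N..int N})"
    have "finite G" unfolding G_def using I by (intro finite_imageI finite_PiE) auto
    then have "\<forall>\<^sub>F n in sequentially. \<forall>x\<in>G. \<bar>h x n\<bar> < \<epsilon> / 2"
    proof (rule eventually_ball_finite, intro ballI)
      fix x assume "x \<in> G"
      then obtain k where "x = ?x (\<lambda>i. of_int (k i) / real N)" by (auto simp: G_def)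
      then have "h x \<longlonglongrightarrow> 0"
        using lim[of "\<lambda>i. of_int (k i) / real N"] by (simp add: h_def)
      from tendstoD[OF this, of "\<epsilon> / 2"] show "\<forall>\<^sub>F n in sequentially. \<bar>h x n\<bar> < \<epsilon> / 2"
        using \<epsilon> by (simp add: dist_real_def)
    qed
    then show ?thesis using R'
    proof eventually_elim
      case (elim n)
      have hx: "\<bar>h (?x u) n\<bar> \<le> \<epsilon>" if u: "\<And>i. i \<in> I \<Longrightarrow> \<bar>u i\<bar> \<le> 1" for u
      proof -
        \<comment> \<open>Rounding down keeps the integers between \<open>- N\<close> and
          \<open>N\<close>; restriction to \<open>I\<close> makes \<open>k\<close> one of the
          finitely many extensional functions.\<close>
        define k where "k = (\<lambda>i\<in>I. \<lfloor>u i * real N\<rfloor>)"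
        define y where "y = ?x (\<lambda>i. of_int (k i) / real N)"
        have "k \<in> I \<rightarrow>\<^sub>E {- int N..int N}"
        proof (rule PiE_I)
          fix i assume i: "i \<in> I"
          have "- real N \<le> u i * real N" "u i * real N \<le> real N"
            using u[OF i] N(2) by (auto simp: abs_le_iff) (metis minus_mult_minus mult_le_cancel_right1 mult_minus_left neg_le_iff_le of_nat_0_le_iff minus_le_iff mult_1 mult_right_mono)
          then have "- int N \<le> \<lfloor>u i * real N\<rfloor>" "\<lfloor>u i * real N\<rfloor> \<le> int N"
            by (auto simp: le_floor_iff floor_le_iff)
          then show "k i \<in> {- int N..int N}" using i by (simp add: k_def)
        qed (simp add: k_def)
        then have "y \<in> G" by (auto simp: G_def y_def)
        then have hy: "\<bar>h y n\<bar> < \<epsilon> / 2" using elim by blast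
        have "norm (?x u - y) = norm (\<Sum>i\<in>I. (u i - of_int (k i) / real N) *\<^sub>R \<phi> i)"
          by (simp add: y_def sum_subtractf scaleR_left_diff_distrib)
        also have "\<dots> \<le> (\<Sum>i\<in>I. (1 / real N) * norm (\<phi> i))"
        proof (rule sum_norm_le)
          fix i assume i: "i \<in> I"
          have "\<bar>u i * real N - of_int \<lfloor>u i * real N\<rfloor>\<bar> \<le> 1" by linarith
          moreover have "u i - of_int (k i) / real N = (u i * real N - of_int \<lfloor>u i * real N\<rfloor>) / real N"
            using i N(2) by (simp add: k_def field_simps)
          ultimately have "\<bar>u i - of_int (k i) / real N\<bar> \<le> 1 / real N"
            using N(2) by (simp add: divide_right_mono)
          then show "norm ((u i - of_int (k i) / real N) *\<^sub>R \<phi> i) \<le> (1 / real N) * norm (\<phi> i)"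
            by (simp only: norm_scaleR mult_right_mono norm_ge_zero real_norm_def)
        qed
        also have "\<dots> = L / real N" by (simp add: L_def sum_divide_distrib)
        finally have xy: "norm (?x u - y) \<le> L / real N" .
        have "\<bar>h (?x u) n - h y n\<bar> \<le> norm (?x u - y) * R' + norm (?x u - y) * R"
          using abs_support_fun_diff_le[of "A n" R' "?x u" y] A(3) elim
            abs_support_fun_diff_le[of "B n" R "?x u" y] B(2,3)
          by (fastforce simp: h_def)
        also have "\<dots> \<le> (L / real N) * (R' + R)"
          unfolding distrib_left[symmetric] using R'0 \<open>0 \<le> R\<close> by (intro mult_right_mono xy) simp
        also have "\<dots> \<le> \<epsilon> / 2" using N \<epsilon> by (simp add: field_simps)
        finally show ?thesis using hy by linarith
      qed
      show ?case
      proof (rule abs_hausdorff_dist_le[OF A(3) B(3)])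
        fix a assume a: "a \<in> A n"
        show "infdist a (B n) \<le> c * real (card I) * \<epsilon>"
        proof (rule infdist_le_support_gap[OF I c B(1) bdB B(3)])
          fix u assume "\<And>i. i \<in> I \<Longrightarrow> \<bar>u i\<bar> \<le> (1::real)"
          then show "blinfun_apply (?x u) a \<le> support_fun (?x u) (B n) + \<epsilon>"
            using hx[of u] le_support_fun[OF A(2) a, of "?x u"] by (simp add: h_def abs_le_iff)
        qed (use \<epsilon> in auto)
      next
        fix b assume b: "b \<in> B n"
        show "infdist b (A n) \<le> c * real (card I) * \<epsilon>"
        proof (rule infdist_le_support_gap[OF I c A(1) A(2) A(3)])
          fix u assume "\<And>i. i \<in> I \<Longrightarrow> \<bar>u i\<bar> \<le> (1::real)"
          then show "blinfun_apply (?x u) b \<le> support_fun (?x u) (A n) + \<epsilon>"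
            using hx[of u] le_support_fun[OF bdB b, of "?x u"] by (simp add: h_def abs_le_iff)
        qed (use \<epsilon> in auto)
      qed
    qed
  qed
  show ?thesis
  proof (rule tendstoI)
    fix e :: real assume e: "e > 0"
    \<comment> \<open>The added 1 keeps \<open>K\<close> positive when \<open>I\<close> is
      empty.\<close>
    define K where "K = c * real (card I) + 1"
    have K: "K > 0" using c(2) by (simp add: K_def add_nonneg_pos)
    define \<epsilon> where "\<epsilon> = e / (2 * K)"
    have "\<epsilon> > 0" using e K by (simp add: \<epsilon>_def)
    moreover have "c * real (card I) * \<epsilon> < e"
    proof -
      have "c * real (card I) * \<epsilon> \<le> K * \<epsilon>"
        using \<open>\<epsilon> > 0\<close> by (simp add: K_def)
      also have "\<dots> = e / 2" using K by (simp add: \<epsilon>_def)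
      finally show ?thesis using e by simp
    qed
    ultimately show "\<forall>\<^sub>F n in sequentially. dist (hausdorff_dist (A n) (B n)) 0 < e"
      using key[of \<epsilon>] by (auto elim!: eventually_mono)
  qed
qed

section \<open>A strong law for uncorrelated variables\<close>

text \<open>The integral of the series is the series of the integrals, hence finite; so the series
  converges almost everywhere and its terms vanish. This does the work of Chebyshev with
  Borel-Cantelli.\<close>

lemma AE_tendsto_0_if_summable_integrals:
  fixes Z :: "nat \<Rightarrow> 'w \<Rightarrow> real"
  assumes Z: "\<And>n. integrable M (Z n)" "\<And>n \<omega>. 0 \<le> Z n \<omega>"
    and le: "\<And>n. integral\<^sup>L M (Z n) \<le> g n" and g: "summable g"
  shows "AE \<omega> in M. (\<lambda>n. Z n \<omega>) \<longlonglongrightarrow> 0"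
proof -
  have [measurable]: "Z n \<in> borel_measurable M" for n using Z(1) by auto
  have g0: "0 \<le> g n" for n
    using order_trans[OF Bochner_Integration.integral_nonneg le] Z(2) by blast
  have "(\<integral>\<^sup>+\<omega>. (\<Sum>n. ennreal (Z n \<omega>)) \<partial>M) = (\<Sum>n. \<integral>\<^sup>+\<omega>. ennreal (Z n \<omega>) \<partial>M)"
    by (intro nn_integral_suminf) auto
  also have "\<dots> = (\<Sum>n. ennreal (integral\<^sup>L M (Z n)))"
    using Z by (simp add: nn_integral_eq_integral)
  also have "\<dots> \<le> (\<Sum>n. ennreal (g n))"
    using le by (intro suminf_le) (auto intro: ennreal_leI)
  also have "\<dots> < \<infinity>"
    using suminf_ennreal_eq[OF g0, of _] summable_sums[OF g]
    by (simp add: suminf_ennreal2[OF g0 g])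
  finally have "AE \<omega> in M. (\<Sum>n. ennreal (Z n \<omega>)) \<noteq> \<infinity>"
    by (intro nn_integral_PInf_AE) auto
  then show ?thesis
  proof eventually_elim
    case (elim \<omega>)
    then have "summable (\<lambda>n. Z n \<omega>)" using Z(2) by (intro summable_suminf_not_top) auto
    then show ?case by (rule summable_LIMSEQ_zero)
  qed
qed

text \<open>Orthogonality of the centred variables bounds the second moment of a sum over
  \<open>J\<close> by \<open>card J * C\<close>, for blocks and initial segments alike. The maximum
  over the gap between consecutive squares is crudely bounded by the sum over the gap.\<close>

lemma (in prob_space) uncorrelated_SLLN:
  fixes X :: "nat \<Rightarrow> 'a \<Rightarrow> real"
  assumes X: "\<And>k. random_variable borel (X k)" "\<And>k. integrable M (\<lambda>\<omega>. (X k \<omega>)\<^sup>2)"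
    and var: "\<And>k. variance (X k) \<le> C"
    and uncor: "\<And>i j. i \<noteq> j \<Longrightarrow> covariance M (X i) (X j) = 0"
  shows "AE \<omega> in M. (\<lambda>n. (\<Sum>k<n. X k \<omega> - expectation (X k)) / real n) \<longlonglongrightarrow> 0"
proof -
  define Y where "Y k \<omega> = X k \<omega> - expectation (X k)" for k \<omega>
  define T where "T J \<omega> = (\<Sum>k\<in>J. Y k \<omega>)" for J \<omega>
  have intX: "integrable M (X k)" for k
    using X by (rule square_integrable_imp_integrable)
  have [measurable]: "Y k \<in> borel_measurable M" for k
    unfolding Y_def using X(1) by measurable
  have intY2: "integrable M (\<lambda>\<omega>. (Y k \<omega>)\<^sup>2)" for k
    unfolding Y_def power2_diff using X(2) intX by simp
  have intYY: "integrable M (\<lambda>\<omega>. Y i \<omega> * Y j \<omega>)" for i j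
  proof (rule Bochner_Integration.integrable_bound)
    show "integrable M (\<lambda>\<omega>. (Y i \<omega>)\<^sup>2 + (Y j \<omega>)\<^sup>2)" using intY2 by simp
    have "\<bar>x * y\<bar> \<le> x\<^sup>2 + y\<^sup>2" for x y :: real
      using sum_squares_bound[of x y] sum_squares_bound[of x "-y"] by (auto simp: abs_le_iff)
    then show "AE \<omega> in M. norm (Y i \<omega> * Y j \<omega>) \<le> norm ((Y i \<omega>)\<^sup>2 + (Y j \<omega>)\<^sup>2)"
      by (simp add: abs_of_nonneg)
  qed simp
  have EYY: "expectation (\<lambda>\<omega>. Y i \<omega> * Y j \<omega>) \<le> (if i = j then C else 0)" for i j
    using var[of i] uncor[of i j] by (auto simp: Y_def covariance_def power2_eq_square)
  have T2: "(T J \<omega>)\<^sup>2 = (\<Sum>i\<in>J. \<Sum>j\<in>J. Y i \<omega> * Y j \<omega>)" for J \<omega>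
    by (simp add: T_def power2_eq_square sum_product)
  have intT: "integrable M (\<lambda>\<omega>. (T J \<omega>)\<^sup>2)" for J
    unfolding T2 by (intro Bochner_Integration.integrable_sum intYY)
  have ET: "expectation (\<lambda>\<omega>. (T J \<omega>)\<^sup>2) \<le> real (card J) * C" if "finite J" for J
  proof -
    have "expectation (\<lambda>\<omega>. (T J \<omega>)\<^sup>2) = (\<Sum>i\<in>J. \<Sum>j\<in>J. expectation (\<lambda>\<omega>. Y i \<omega> * Y j \<omega>))"
      unfolding T2 by (subst Bochner_Integration.integral_sum,
        (intro Bochner_Integration.integrable_sum intYY)[1])
        (intro sum.cong refl Bochner_Integration.integral_sum intYY)
    also have "\<dots> \<le> (\<Sum>i\<in>J. \<Sum>j\<in>J. if i = j then C else 0)"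
      by (intro sum_mono EYY)
    also have "\<dots> = real (card J) * C" using that by simp
    finally show ?thesis .
  qed
  have C: "C \<ge> 0"
    using order_trans[OF Bochner_Integration.integral_nonneg var] zero_le_power2 by blast
  \<comment> \<open>\<open>Z n\<close> dominates the squared partial sum up to \<open>m\<close> for
    every \<open>m\<close> with integer square root \<open>n\<close>, by (x + y)^2 <= 2 x^2 + 2 y^2.
    The range ends at \<open>n\<^sup>2 + 2 * n\<close>, just before the next square.\<close>
  define Z where "Z n \<omega> = 2 * (T {..<n\<^sup>2} \<omega>)\<^sup>2 + 2 * (\<Sum>m\<in>{n\<^sup>2..n\<^sup>2 + 2 * n}. (T {n\<^sup>2..<m} \<omega>)\<^sup>2)"
    for n \<omega>
  have intZ: "integrable M (Z n)" for n
    unfolding Z_def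
    by (intro Bochner_Integration.integrable_add integrable_mult_right
        Bochner_Integration.integrable_sum intT)
  have Z0: "0 \<le> Z n \<omega>" for n \<omega>
    unfolding Z_def by (intro add_nonneg_nonneg mult_nonneg_nonneg sum_nonneg) auto
  have EZ: "expectation (Z n) \<le> 14 * C * real n ^ 2" for n
  proof -
    have "expectation (Z n) = 2 * expectation (\<lambda>\<omega>. (T {..<n\<^sup>2} \<omega>)\<^sup>2)
        + 2 * (\<Sum>m\<in>{n\<^sup>2..n\<^sup>2 + 2 * n}. expectation (\<lambda>\<omega>. (T {n\<^sup>2..<m} \<omega>)\<^sup>2))"
      unfolding Z_def using intT by simp
    also have "\<dots> \<le> 2 * (real (n\<^sup>2) * C) + 2 * (\<Sum>m\<in>{n\<^sup>2..n\<^sup>2 + 2 * n}. real (2 * n) * C)"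
    proof (intro add_mono mult_left_mono sum_mono)
      show "expectation (\<lambda>\<omega>. (T {..<n\<^sup>2} \<omega>)\<^sup>2) \<le> real (n\<^sup>2) * C"
        using ET[of "{..<n\<^sup>2}"] by simp
      fix m assume "m \<in> {n\<^sup>2..n\<^sup>2 + 2 * n}"
      then have "card {n\<^sup>2..<m} \<le> 2 * n" by auto
      then have "real (card {n\<^sup>2..<m}) * C \<le> real (2 * n) * C"
        using C by (intro mult_right_mono) (simp_all only: of_nat_le_iff)
      then show "expectation (\<lambda>\<omega>. (T {n\<^sup>2..<m} \<omega>)\<^sup>2) \<le> real (2 * n) * C"
        using ET[of "{n\<^sup>2..<m}"] by simp
    qed auto
    \<comment> \<open>There are \<open>2 * n + 1\<close> values of \<open>m\<close> with at most
      \<open>2 * n\<close> terms each, which gives 8 n^2 + 4 n; the initial segment adds 2 n^2. Then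
      n <= n^2 for natural n.\<close>
    also have "\<dots> = C * (10 * real n ^ 2 + 4 * real n)"
      by (simp add: algebra_simps power2_eq_square)
    also have "\<dots> \<le> C * (14 * real n ^ 2)"
      using C by (intro mult_left_mono) (auto simp: power2_eq_square, cases n, auto)
    finally show ?thesis by (simp add: mult_ac)
  qed
  have "AE \<omega> in M. (\<lambda>n. Z n \<omega> / real n ^ 4) \<longlonglongrightarrow> 0"
  proof (rule AE_tendsto_0_if_summable_integrals)
    show "integrable M (\<lambda>\<omega>. Z n \<omega> / real n ^ 4)" for n using intZ by simp
    show "0 \<le> Z n \<omega> / real n ^ 4" for n \<omega> using Z0 by simp
    show "expectation (\<lambda>\<omega>. Z n \<omega> / real n ^ 4) \<le> 14 * C * inverse (real n ^ 2)" for n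
    \<comment> \<open>At \<open>n = 0\<close> both sides are 0, by the conventions on division by
      0.\<close>
    proof (cases "n = 0")
      case False
      have "expectation (\<lambda>\<omega>. Z n \<omega> / real n ^ 4) \<le> (14 * C * real n ^ 2) / real n ^ 4"
        using EZ by (simp add: divide_right_mono)
      also have "\<dots> = 14 * C * inverse (real n ^ 2)"
        using False by (simp add: field_simps power4_eq_xxxx power2_eq_square)
      finally show ?thesis .
    qed simp
    show "summable (\<lambda>n. 14 * C * inverse (real n ^ 2))"
      by (intro summable_mult inverse_power_summable) simp
  qed
  then show ?thesis
  proof eventually_elim
    case (elim \<omega>)
    define S where "S m = T {..<m} \<omega>" for m
    have "(\<lambda>m. (S m / real m)\<^sup>2) \<longlonglongrightarrow> 0"
    proof (rule tendsto_sandwich[where f = "\<lambda>_. 0"])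
      \<comment> \<open>Reindexing: every \<open>m\<close> belongs to the block of its integer
        square root, which tends to infinity with \<open>m\<close>.\<close>
      have "filterlim floor_sqrt at_top sequentially"
        unfolding filterlim_at_top
        by (auto simp: eventually_sequentially le_floor_sqrt_iff)
      from filterlim_compose[OF elim this]
      show "(\<lambda>m. Z (floor_sqrt m) \<omega> / real (floor_sqrt m) ^ 4) \<longlonglongrightarrow> 0" .
      show "\<forall>\<^sub>F m in sequentially. (S m / real m)\<^sup>2 \<le> Z (floor_sqrt m) \<omega> / real (floor_sqrt m) ^ 4"
        using eventually_gt_at_top[of 0]
      proof eventually_elim
        case (elim m)
        define n where "n = floor_sqrt m"
        have n: "n > 0" "n\<^sup>2 \<le> m" "m \<le> n\<^sup>2 + 2 * n"
          using elim Suc_floor_sqrt_power2_gt[of m] floor_sqrt_power2_le[of m]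
          by (auto simp: n_def power2_eq_square)
        have "{..<m} = {..<n\<^sup>2} \<union> {n\<^sup>2..<m}" using n by auto
        then have S: "S m = T {..<n\<^sup>2} \<omega> + T {n\<^sup>2..<m} \<omega>"
          unfolding S_def T_def by (simp add: sum.union_disjoint ivl_disj_int)
        have "(S m)\<^sup>2 \<le> 2 * (T {..<n\<^sup>2} \<omega>)\<^sup>2 + 2 * (T {n\<^sup>2..<m} \<omega>)\<^sup>2"
          unfolding S using sum_squares_bound[of "T {..<n\<^sup>2} \<omega>" "T {n\<^sup>2..<m} \<omega>"]
          by (simp add: power2_sum)
        also have "(T {n\<^sup>2..<m} \<omega>)\<^sup>2 \<le> (\<Sum>m\<in>{n\<^sup>2..n\<^sup>2 + 2 * n}. (T {n\<^sup>2..<m} \<omega>)\<^sup>2)"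
          using n by (intro member_le_sum[of m _ "\<lambda>m. (T {n\<^sup>2..<m} \<omega>)\<^sup>2"]) auto
        finally have "(S m)\<^sup>2 \<le> Z n \<omega>" by (simp add: Z_def)
        moreover have "real n ^ 4 \<le> (real m)\<^sup>2"
        proof -
          have "(real (n\<^sup>2))\<^sup>2 \<le> (real m)\<^sup>2" using n(2) by (intro power_mono) (simp only: of_nat_le_iff, simp)
          then show ?thesis by (simp flip: power_mult)
        qed
        ultimately have "(S m)\<^sup>2 / (real m)\<^sup>2 \<le> Z n \<omega> / real n ^ 4"
          using n(1) Z0 by (intro frac_le) auto
        then show ?case by (simp add: power_divide n_def)
      qed
    qed auto
    from tendsto_real_sqrt[OF this] have "(\<lambda>m. S m / real m) \<longlonglongrightarrow> 0"
      by (simp only: real_sqrt_abs real_sqrt_zero tendsto_rabs_zero_iff)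
    then show ?case by (simp add: S_def T_def Y_def)
  qed
qed

section \<open>Measurable selections and the Aumann integral\<close>

text \<open>Kuratowski--Ryll-Nardzewski: successive approximation by points of a countable dense set.\<close>

lemma measurable_selection:
  fixes F :: "'w \<Rightarrow> 'a::{banach, second_countable_topology} set"
  assumes "set_random_variable M F"
  obtains f where "f \<in> borel_measurable M" "\<And>\<omega>. \<omega> \<in> space M \<Longrightarrow> f \<omega> \<in> F \<omega>"
proof -
  obtain D :: "'a set" where D: "countable D" "\<And>X. open X \<Longrightarrow> X \<noteq> {} \<Longrightarrow> \<exists>d\<in>D. d \<in> X"
    using countable_dense_setE by blast
  have "D \<noteq> {}" using D(2)[of UNIV] by auto
  define q where "q = from_nat_into D"
  have q: "\<exists>j. dist (q j) y < e" if "e > 0" for y e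
  proof -
    obtain d where "d \<in> D" "d \<in> ball y e" using D(2)[of "ball y e"] \<open>e > 0\<close> by auto
    then show ?thesis
      using from_nat_into_surj[OF D(1), of d] by (auto simp: q_def dist_commute)
  qed
  let ?r = "\<lambda>n. (1/2::real) ^ n"
  define near where "near n j \<omega> \<longleftrightarrow> F \<omega> \<inter> ball (q j) (?r n) \<noteq> {}" for n j \<omega>
  \<comment> \<open>Taking the least admissible index keeps the choice measurable; the distance
    constraint makes the approximants Cauchy at a geometric rate.\<close>
  define idx where "idx = rec_nat (\<lambda>\<omega>. LEAST j. near 0 j \<omega>)
    (\<lambda>n i \<omega>. LEAST j. near (Suc n) j \<omega> \<and> dist (q j) (q (i \<omega>)) < 2 * ?r n)"
  have idx_0: "idx 0 = (\<lambda>\<omega>. LEAST j. near 0 j \<omega>)"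
    and idx_Suc: "idx (Suc n) =
      (\<lambda>\<omega>. LEAST j. near (Suc n) j \<omega> \<and> dist (q j) (q (idx n \<omega>)) < 2 * ?r n)" for n
    by (simp_all add: idx_def)
  have [measurable]: "Measurable.pred M (near n j)" for n j
    using assms unfolding pred_def near_def set_random_variable_def by simp
  have idx_meas[measurable]: "idx n \<in> M \<rightarrow>\<^sub>M count_space UNIV" for n
  proof (induction n)
    case 0
    show ?case unfolding idx_0 by measurable
  next
    case (Suc n)
    note [measurable] = Suc
    show ?case unfolding idx_Suc by measurable
  qed
  define f where "f n \<omega> = q (idx n \<omega>)" for n \<omega>
  have f_meas: "f n \<in> borel_measurable M" for n
    unfolding f_def by measurable
  have near_idx: "near n (idx n \<omega>) \<omega>"
    and step: "dist (f (Suc n) \<omega>) (f n \<omega>) < 2 * ?r n" if \<omega>: "\<omega> \<in> space M" for n \<omega>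
  proof -
    have ne: "F \<omega> \<noteq> {}" using assms \<omega> by (auto simp: set_random_variable_def)
    \<comment> \<open>Approximate a point \<open>y\<close> of \<open>F \<omega>\<close> close to
      \<open>q i\<close>: the two errors add up to less than 3/2 of \<open>(1/2) ^ n\<close>, within
      the tolerance.\<close>
    have near_ex: "\<exists>j. near (Suc n) j \<omega> \<and> dist (q j) (q i) < 2 * ?r n" if "near n i \<omega>" for n i
    proof -
      obtain y where y: "y \<in> F \<omega>" "dist (q i) y < ?r n" using \<open>near n i \<omega>\<close> by (auto simp: near_def)
      obtain j where j: "dist (q j) y < ?r (Suc n)" using q[of "?r (Suc n)" y] by auto
      have "dist (q j) (q i) \<le> dist (q j) y + dist (q i) y" by (rule dist_triangle2)
      also have "\<dots> < 2 * ?r n" using y(2) j zero_le_dist[of "q j" y] unfolding power_Suc by linarith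
      finally have "dist (q j) (q i) < 2 * ?r n" .
      moreover have "y \<in> F \<omega> \<inter> ball (q j) (?r (Suc n))" using y(1) j by simp
      ultimately have "near (Suc n) j \<omega> \<and> dist (q j) (q i) < 2 * ?r n"
        by (auto simp only: near_def)
      then show ?thesis ..
    qed
    have near_all: "near n (idx n \<omega>) \<omega>" for n
    proof (induction n)
      case 0
      obtain y where y: "y \<in> F \<omega>" using ne by blast
      obtain j where "dist (q j) y < 1" using q[of 1 y] by auto
      then have "near 0 j \<omega>" using y by (auto simp: near_def)
      then show ?case unfolding idx_0 by (rule LeastI)
    next
      case (Suc n)
      from LeastI_ex[OF near_ex[OF this]] show ?case by (simp add: idx_Suc)
    qed
    show "near n (idx n \<omega>) \<omega>" by (rule near_all)
    from LeastI_ex[OF near_ex[OF near_all[of n]]] show "dist (f (Suc n) \<omega>) (f n \<omega>) < 2 * ?r n"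
      by (simp add: f_def idx_Suc)
  qed
  have conv: "convergent (\<lambda>n. f n \<omega>)" if \<omega>: "\<omega> \<in> space M" for \<omega>
  proof -
    have "summable (\<lambda>n. 2 * ?r n)"
      by (rule summable_mult, rule summable_geometric) simp
    moreover have "norm (f (Suc n) \<omega> - f n \<omega>) \<le> 2 * ?r n" for n
      using step[OF \<omega>, of n] unfolding dist_norm by (rule less_imp_le)
    ultimately have "summable (\<lambda>n. f (Suc n) \<omega> - f n \<omega>)"
      by (rule summable_comparison_test'[where N = 0])
    then have "convergent (\<lambda>n. f n \<omega> - f 0 \<omega>)"
      unfolding summable_iff_convergent
      using sum_lessThan_telescope[of "\<lambda>n. f n \<omega>"] by (simp only:)
    then show ?thesis by (simp add: convergent_diff_const_right_iff)
  qed
  define g where "g \<omega> = lim (\<lambda>n. f n \<omega>)" for \<omega>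
  have lim: "(\<lambda>n. f n \<omega>) \<longlonglongrightarrow> g \<omega>" if "\<omega> \<in> space M" for \<omega>
    using conv[OF that] by (simp add: g_def convergent_LIMSEQ_iff)
  show ?thesis
  proof (rule that)
    show "g \<in> borel_measurable M"
      using f_meas lim by (rule borel_measurable_LIMSEQ_metric)
    fix \<omega> assume \<omega>: "\<omega> \<in> space M"
    have "\<exists>y. y \<in> F \<omega> \<and> dist (f n \<omega>) y < ?r n" for n
      using near_idx[OF \<omega>, of n] by (auto simp: near_def f_def)
    \<comment> \<open>The approximants may lie outside \<open>F \<omega>\<close>; the nearby points
      \<open>y n\<close> lie inside and share the limit, which closedness retains.\<close>
    then obtain y where y: "\<And>n. y n \<in> F \<omega>" "\<And>n. dist (f n \<omega>) (y n) < ?r n" by metis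
    have "(\<lambda>n. f n \<omega> - y n) \<longlonglongrightarrow> 0"
    proof (rule Lim_null_comparison)
      show "\<forall>\<^sub>F n in sequentially. norm (f n \<omega> - y n) \<le> ?r n"
        using y(2) by (auto simp: dist_norm less_imp_le)
      show "?r \<longlonglongrightarrow> 0" by (intro LIMSEQ_power_zero) simp
    qed
    from tendsto_diff[OF lim[OF \<omega>] this] have "y \<longlonglongrightarrow> g \<omega>" by simp
    moreover have "closed (F \<omega>)" using assms \<omega> by (simp add: set_random_variable_def)
    ultimately show "g \<omega> \<in> F \<omega>" using y(1) closed_sequentially by blast
  qed
qed

section \<open>Measurability and integrability of support functions and set norms\<close>

lemma Pkc_random_variableD:
  assumes "Pkc_random_variable M F" "\<omega> \<in> space M"
  shows "F \<omega> \<noteq> {}" "bounded (F \<omega>)" "convex (F \<omega>)" "F \<omega> \<in> Pk"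
  using assms by (auto simp: Pkc_random_variable_def Pkc_def Pk_def compact_imp_bounded)

lemma hitting_set_measurable:
  assumes "Pkc_random_variable M F" "open U"
  shows "{\<omega> \<in> space M. F \<omega> \<inter> U \<noteq> {}} \<in> sets M"
  using assms by (simp add: Pkc_random_variable_def set_random_variable_def)

lemma open_blinfun_greater:
  fixes x :: "'a::real_normed_vector \<Rightarrow>\<^sub>L real"
  shows "open {a. r < blinfun_apply x a}"
  by (intro open_Collect_less continuous_intros)

text \<open>The support function exceeds \<open>r\<close> exactly when the set meets the open
  half-space where \<open>x\<close> exceeds \<open>r\<close>, an event by the definition of a
  set-valued random variable.\<close>

lemma borel_measurable_support_fun:
  assumes F: "Pkc_random_variable M F"
  shows "(\<lambda>\<omega>. support_fun x (F \<omega>)) \<in> borel_measurable M"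
proof (subst borel_measurable_iff_greater, rule allI)
  fix r
  have "{\<omega> \<in> space M. r < support_fun x (F \<omega>)} = {\<omega> \<in> space M. F \<omega> \<inter> {a. r < blinfun_apply x a} \<noteq> {}}"
    using Pkc_random_variableD[OF F] by (auto simp: less_support_fun_iff)
  then show "{\<omega> \<in> space M. r < support_fun x (F \<omega>)} \<in> sets M"
    using hitting_set_measurable[OF F open_blinfun_greater] by simp
qed

lemma norm_le_set_norm:
  assumes "A \<in> Pk" "a \<in> A"
  shows "norm a \<le> set_norm A"
  using assms
  by (auto simp: set_norm_eq Pk_def bdd_above_norm compact_imp_bounded intro!: cSUP_upper)

lemma set_norm_nonneg: "A \<in> Pk \<Longrightarrow> 0 \<le> set_norm A"
  unfolding set_norm_def by (intro hausdorff_dist_nonneg) (auto simp: Pk_def)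

lemma borel_measurable_set_norm:
  assumes F: "Pkc_random_variable M F"
  shows "(\<lambda>\<omega>. set_norm (F \<omega>)) \<in> borel_measurable M"
proof (subst borel_measurable_iff_greater, rule allI)
  fix r
  have "r < set_norm (F \<omega>) \<longleftrightarrow> F \<omega> \<inter> {a. r < norm a} \<noteq> {}" if \<omega>: "\<omega> \<in> space M" for \<omega>
    using Pkc_random_variableD[OF F \<omega>] less_cSUP_iff[of "F \<omega>" norm r]
    by (auto simp: set_norm_eq bdd_above_norm)
  then have "{\<omega> \<in> space M. r < set_norm (F \<omega>)} = {\<omega> \<in> space M. F \<omega> \<inter> {a. r < norm a} \<noteq> {}}"
    by blast
  moreover have "open {a::'b. r < norm a}" by (intro open_Collect_less continuous_intros)
  ultimately show "{\<omega> \<in> space M. r < set_norm (F \<omega>)} \<in> sets M"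
    using hitting_set_measurable[OF F] by simp
qed

lemma abs_support_fun_le_set_norm:
  assumes "Pkc_random_variable M F" "\<omega> \<in> space M"
  shows "\<bar>support_fun x (F \<omega>)\<bar> \<le> norm x * set_norm (F \<omega>)"
  using Pkc_random_variableD[OF assms] by (intro abs_support_fun_le norm_le_set_norm)

lemma Lp_Pkc_random_variable: "F \<in> Lp_Pkc p M \<Longrightarrow> Pkc_random_variable M F"
  by (simp add: Lp_Pkc_def)

lemma integrable_set_norm_square:
  assumes F: "F \<in> Lp_Pkc 2 M"
  shows "integrable M (\<lambda>\<omega>. (set_norm (F \<omega>))\<^sup>2)"
proof (rule integrableI_nonneg)
  note rv = Lp_Pkc_random_variable[OF F]
  show "(\<lambda>\<omega>. (set_norm (F \<omega>))\<^sup>2) \<in> borel_measurable M"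
    using borel_measurable_set_norm[OF rv] by measurable
  have "(\<integral>\<^sup>+\<omega>. ennreal ((set_norm (F \<omega>))\<^sup>2) \<partial>M) = (\<integral>\<^sup>+\<omega>. ennreal (set_norm (F \<omega>) powr 2) \<partial>M)"
    using powr_numeral[OF set_norm_nonneg[OF Pkc_random_variableD(4)[OF rv]], of _ "num.Bit0 num.One"]
    by (intro nn_integral_cong) simp
  then show "(\<integral>\<^sup>+\<omega>. ennreal ((set_norm (F \<omega>))\<^sup>2) \<partial>M) < \<infinity>"
    using F by (simp add: Lp_Pkc_def)
qed auto

lemma integrable_support_fun_square:
  assumes F: "F \<in> Lp_Pkc 2 M"
  shows "integrable M (\<lambda>\<omega>. (support_fun x (F \<omega>))\<^sup>2)"
proof (rule Bochner_Integration.integrable_bound)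
  note rv = Lp_Pkc_random_variable[OF F]
  show "integrable M (\<lambda>\<omega>. (norm x)\<^sup>2 * (set_norm (F \<omega>))\<^sup>2)"
    using integrable_set_norm_square[OF F] by simp
  show "(\<lambda>\<omega>. (support_fun x (F \<omega>))\<^sup>2) \<in> borel_measurable M"
    using borel_measurable_support_fun[OF rv] by measurable
  show "AE \<omega> in M. norm ((support_fun x (F \<omega>))\<^sup>2) \<le> norm ((norm x)\<^sup>2 * (set_norm (F \<omega>))\<^sup>2)"
  proof (rule AE_I2)
    fix \<omega> assume "\<omega> \<in> space M"
    from power_mono[OF abs_support_fun_le_set_norm[OF rv this, of x], of 2]
    show "norm ((support_fun x (F \<omega>))\<^sup>2) \<le> norm ((norm x)\<^sup>2 * (set_norm (F \<omega>))\<^sup>2)"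
      by (simp add: power_mult_distrib)
  qed
qed

section \<open>Selections, the Aumann expectation and its support function\<close>

context prob_space
begin

lemma integrable_set_norm: "F \<in> Lp_Pkc 2 M \<Longrightarrow> integrable M (\<lambda>\<omega>. set_norm (F \<omega>))"
  by (rule square_integrable_imp_integrable[OF borel_measurable_set_norm[OF Lp_Pkc_random_variable]
        integrable_set_norm_square])

lemma integrable_support_fun: "F \<in> Lp_Pkc 2 M \<Longrightarrow> integrable M (\<lambda>\<omega>. support_fun x (F \<omega>))"
  by (rule square_integrable_imp_integrable[OF borel_measurable_support_fun[OF Lp_Pkc_random_variable]
        integrable_support_fun_square])

lemma integrable_selection:
  fixes F :: "'a \<Rightarrow> 'b::{banach, second_countable_topology} set"
  assumes F: "F \<in> Lp_Pkc 2 M" and f: "f \<in> borel_measurable M" "AE \<omega> in M. f \<omega> \<in> F \<omega>"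
  shows "integrable M f" "norm (integral\<^sup>L M f) \<le> expectation (\<lambda>\<omega>. set_norm (F \<omega>))"
proof -
  note rv = Lp_Pkc_random_variable[OF F]
  have le: "AE \<omega> in M. norm (f \<omega>) \<le> set_norm (F \<omega>)"
    using f(2) AE_space
    by eventually_elim (auto intro: norm_le_set_norm Pkc_random_variableD(4)[OF rv])
  have "AE \<omega> in M. norm (f \<omega>) \<le> norm (set_norm (F \<omega>))" using le by eventually_elim simp
  with integrable_set_norm[OF F] f(1) show "integrable M f"
    by (rule Bochner_Integration.integrable_bound)
  then have "expectation (\<lambda>\<omega>. norm (f \<omega>)) \<le> expectation (\<lambda>\<omega>. set_norm (F \<omega>))"
    using le by (intro integral_mono_AE integrable_norm integrable_set_norm[OF F])
  then show "norm (integral\<^sup>L M f) \<le> expectation (\<lambda>\<omega>. set_norm (F \<omega>))"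
    by (rule order_trans[OF integral_norm_bound])
qed

lemma norm_le_in_aumann_expectation:
  assumes "F \<in> Lp_Pkc 2 M" "a \<in> aumann_expectation M F"
  shows "norm a \<le> expectation (\<lambda>\<omega>. set_norm (F \<omega>))"
  using assms integrable_selection(2)[OF assms(1)] by (auto simp: aumann_expectation_def)

text \<open>A pointwise convex combination of selections is a selection, because the values are
  convex.\<close>

lemma convex_aumann_expectation:
  assumes "Pkc_random_variable M F"
  shows "convex (aumann_expectation M F)"
  unfolding convex_alt
proof (intro ballI allI impI)
  fix a b and t :: real
  assume "a \<in> aumann_expectation M F" "b \<in> aumann_expectation M F" and t: "0 \<le> t \<and> t \<le> 1"
  then obtain f g where f: "integrable M f" "AE \<omega> in M. f \<omega> \<in> F \<omega>" "a = integral\<^sup>L M f"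
    and g: "integrable M g" "AE \<omega> in M. g \<omega> \<in> F \<omega>" "b = integral\<^sup>L M g"
    by (auto simp: aumann_expectation_def)
  let ?h = "\<lambda>\<omega>. (1 - t) *\<^sub>R f \<omega> + t *\<^sub>R g \<omega>"
  have "AE \<omega> in M. ?h \<omega> \<in> F \<omega>"
    using f(2) g(2) AE_space
  proof eventually_elim
    case (elim \<omega>)
    then show ?case
      using Pkc_random_variableD(3)[OF assms, of \<omega>] t by (simp add: convex_alt)
  qed
  moreover have "integrable M ?h" using f g by simp
  moreover have "(1 - t) *\<^sub>R a + t *\<^sub>R b = integral\<^sup>L M ?h" using f g by simp
  ultimately show "(1 - t) *\<^sub>R a + t *\<^sub>R b \<in> aumann_expectation M F"
    unfolding aumann_expectation_def by blast
qed

text \<open>Maximisers are replaced by points within \<open>\<epsilon>\<close> of the maximum: these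
  are cut out by a strict inequality, an open condition to which the hitting measurability of
  \<open>F\<close> applies.\<close>

lemma near_maximal_selection:
  fixes F :: "'a \<Rightarrow> 'b::{banach, second_countable_topology} set"
  assumes F: "Pkc_random_variable M F" and \<epsilon>: "\<epsilon> > 0"
  obtains f where "f \<in> borel_measurable M" "\<And>\<omega>. \<omega> \<in> space M \<Longrightarrow> f \<omega> \<in> F \<omega>"
    "\<And>\<omega>. \<omega> \<in> space M \<Longrightarrow> support_fun x (F \<omega>) - \<epsilon> \<le> blinfun_apply x (f \<omega>)"
proof -
  let ?s = "\<lambda>\<omega>. support_fun x (F \<omega>) - \<epsilon>"
  \<comment> \<open>The closure gives closed values without changing which open sets are met; the
    price is a weak inequality for the selection.\<close>
  define G where "G \<omega> = closure (F \<omega> \<inter> {a. ?s \<omega> < blinfun_apply x a})" for \<omega>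
  have [measurable]: "?s \<in> borel_measurable M"
    using borel_measurable_support_fun[OF F] by measurable
  have "set_random_variable M G"
    unfolding set_random_variable_def
  proof (intro conjI ballI allI impI)
    fix \<omega> assume \<omega>: "\<omega> \<in> space M"
    have "?s \<omega> < support_fun x (F \<omega>)" using \<epsilon> by simp
    then show "G \<omega> \<noteq> {}"
      using less_support_fun_iff[OF Pkc_random_variableD(1,2)[OF F \<omega>]] by (auto simp: G_def)
    show "closed (G \<omega>)" by (simp add: G_def)
  next
    fix U :: "'b set" assume U: "open U"
    \<comment> \<open>A rational \<open>r\<close> separates the random threshold from the value at
      the point, leaving a measurable comparison and a hitting event for a fixed open set.\<close>
    have "G \<omega> \<inter> U \<noteq> {} \<longleftrightarrow>
        (\<exists>r\<in>\<rat>. ?s \<omega> \<le> r \<and> F \<omega> \<inter> (U \<inter> {a. r < blinfun_apply x a}) \<noteq> {})" for \<omega>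
    proof -
      have "G \<omega> \<inter> U \<noteq> {} \<longleftrightarrow> (\<exists>a\<in>F \<omega> \<inter> U. ?s \<omega> < blinfun_apply x a)"
        using open_Int_closure_eq_empty[OF U, of "F \<omega> \<inter> {a. ?s \<omega> < blinfun_apply x a}"]
        by (auto simp: G_def Int_commute)
      also have "\<dots> \<longleftrightarrow> (\<exists>a\<in>F \<omega> \<inter> U. \<exists>r\<in>\<rat>. ?s \<omega> \<le> r \<and> r < blinfun_apply x a)"
      proof -
        have *: "u < v \<longleftrightarrow> (\<exists>r\<in>\<rat>. u \<le> r \<and> r < v)" for u v :: real
        proof
          assume "u < v"
          then obtain r where "r \<in> \<rat>" "u < r" "r < v" using Rats_dense_in_real by blast
          then show "\<exists>r\<in>\<rat>. u \<le> r \<and> r < v" by (intro bexI[of _ r]) auto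
        qed (elim bexE conjE, rule le_less_trans)
        show ?thesis by (intro bex_cong refl *)
      qed
      finally show ?thesis by blast
    qed
    then have "{\<omega> \<in> space M. G \<omega> \<inter> U \<noteq> {}} =
        (\<Union>r\<in>\<rat>. {\<omega> \<in> space M. ?s \<omega> \<le> r} \<inter> {\<omega> \<in> space M. F \<omega> \<inter> (U \<inter> {a. r < blinfun_apply x a}) \<noteq> {}})"
      by (simp only:) blast
    also have "\<dots> \<in> sets M"
      using U by (intro sets.countable_UN'' countable_rat sets.Int hitting_set_measurable[OF F] open_Int
          open_blinfun_greater) measurable
    finally show "{\<omega> \<in> space M. G \<omega> \<inter> U \<noteq> {}} \<in> sets M" .
  qed
  then obtain f where f: "f \<in> borel_measurable M" "\<And>\<omega>. \<omega> \<in> space M \<Longrightarrow> f \<omega> \<in> G \<omega>"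
    using measurable_selection by blast
  show ?thesis
  proof (rule that[OF f(1)])
    fix \<omega> assume \<omega>: "\<omega> \<in> space M"
    have "closed (F \<omega>)" using Pkc_random_variableD(4)[OF F \<omega>] by (simp add: Pk_def compact_imp_closed)
    moreover have "closed {a. ?s \<omega> \<le> blinfun_apply x a}"
      by (intro closed_Collect_le continuous_intros)
    ultimately have "G \<omega> \<subseteq> F \<omega> \<inter> {a. ?s \<omega> \<le> blinfun_apply x a}"
      unfolding G_def by (intro closure_minimal closed_Int) auto
    then show "f \<omega> \<in> F \<omega>" "?s \<omega> \<le> blinfun_apply x (f \<omega>)" using f(2)[OF \<omega>] by auto
  qed
qed

lemma aumann_expectation_nonempty:
  fixes F :: "'a \<Rightarrow> 'b::{banach, second_countable_topology} set"
  assumes F: "F \<in> Lp_Pkc 2 M"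
  shows "aumann_expectation M F \<noteq> {}"
proof -
  have "set_random_variable M F"
    using Lp_Pkc_random_variable[OF F] by (simp add: Pkc_random_variable_def)
  then obtain f where f: "f \<in> borel_measurable M" "\<And>\<omega>. \<omega> \<in> space M \<Longrightarrow> f \<omega> \<in> F \<omega>"
    using measurable_selection by blast
  then have "AE \<omega> in M. f \<omega> \<in> F \<omega>" by (intro AE_I2)
  then show ?thesis
    using integrable_selection(1)[OF F f(1)] by (auto simp: aumann_expectation_def)
qed

text \<open>Every selection stays below the support function almost surely, which bounds one side; a
  selection within \<open>\<epsilon>\<close> of it everywhere gives the other, as the total mass is
  1.\<close>

lemma support_fun_aumann_expectation:
  fixes F :: "'a \<Rightarrow> 'b::{banach, second_countable_topology} set"
  assumes F: "F \<in> Lp_Pkc 2 M"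
  shows "support_fun x (aumann_expectation M F) = expectation (\<lambda>\<omega>. support_fun x (F \<omega>))"
proof (rule antisym)
  note rv = Lp_Pkc_random_variable[OF F]
  note int = integrable_support_fun[OF F, of x]
  have ne: "aumann_expectation M F \<noteq> {}" using F by (rule aumann_expectation_nonempty)
  show "support_fun x (aumann_expectation M F) \<le> expectation (\<lambda>\<omega>. support_fun x (F \<omega>))"
  proof (rule support_fun_le[OF ne])
    fix a assume "a \<in> aumann_expectation M F"
    then obtain f where f: "integrable M f" "AE \<omega> in M. f \<omega> \<in> F \<omega>" "a = integral\<^sup>L M f"
      by (auto simp: aumann_expectation_def)
    have "blinfun_apply x a = expectation (\<lambda>\<omega>. blinfun_apply x (f \<omega>))"
      unfolding f(3) using f(1) by (simp add: integral_bounded_linear[OF blinfun.bounded_linear_right])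
    also have "\<dots> \<le> expectation (\<lambda>\<omega>. support_fun x (F \<omega>))"
    proof (rule integral_mono_AE[OF _ int])
      show "integrable M (\<lambda>\<omega>. blinfun_apply x (f \<omega>))"
        using f(1) by (rule integrable_bounded_linear[OF blinfun.bounded_linear_right])
      show "AE \<omega> in M. blinfun_apply x (f \<omega>) \<le> support_fun x (F \<omega>)"
        using f(2) AE_space
        by eventually_elim (auto intro: le_support_fun Pkc_random_variableD(2)[OF rv])
    qed
    finally show "blinfun_apply x a \<le> expectation (\<lambda>\<omega>. support_fun x (F \<omega>))" .
  qed
  have "expectation (\<lambda>\<omega>. support_fun x (F \<omega>)) \<le> support_fun x (aumann_expectation M F) + \<epsilon>"
    if \<epsilon>: "\<epsilon> > 0" for \<epsilon>
  proof -
    obtain f where f: "f \<in> borel_measurable M" "\<And>\<omega>. \<omega> \<in> space M \<Longrightarrow> f \<omega> \<in> F \<omega>"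
      "\<And>\<omega>. \<omega> \<in> space M \<Longrightarrow> support_fun x (F \<omega>) - \<epsilon> \<le> blinfun_apply x (f \<omega>)"
      using near_maximal_selection[OF rv \<epsilon>, of x] by blast
    have AE: "AE \<omega> in M. f \<omega> \<in> F \<omega>" using f(2) by (intro AE_I2)
    have intf: "integrable M f" using integrable_selection(1)[OF F f(1) AE] .
    have "expectation (\<lambda>\<omega>. support_fun x (F \<omega>)) - \<epsilon> = expectation (\<lambda>\<omega>. support_fun x (F \<omega>) - \<epsilon>)"
      using int by (simp add: prob_space)
    also have "\<dots> \<le> expectation (\<lambda>\<omega>. blinfun_apply x (f \<omega>))"
      using int integrable_bounded_linear[OF blinfun.bounded_linear_right intf] f(3)
      by (intro integral_mono) auto
    also have "\<dots> = blinfun_apply x (integral\<^sup>L M f)"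
      using intf by (simp add: integral_bounded_linear[OF blinfun.bounded_linear_right])
    also have "\<dots> \<le> support_fun x (aumann_expectation M F)"
    proof (rule le_support_fun)
      show "bounded (aumann_expectation M F)"
        using norm_le_in_aumann_expectation[OF F] boundedI by blast
      show "integral\<^sup>L M f \<in> aumann_expectation M F"
        using intf AE by (auto simp: aumann_expectation_def)
    qed
    finally show ?thesis by simp
  qed
  then show "expectation (\<lambda>\<omega>. support_fun x (F \<omega>)) \<le> support_fun x (aumann_expectation M F)"
    by (rule field_le_epsilon)
qed

text \<open>No measurability of the compact families in the definition of compact uniform integrability
  is available, hence the detour through the measurable truncation
  \<^term>\<open>max 0 (set_norm A - r)\<close>.\<close>

lemma compactly_uniformly_integrable_bound:
  fixes V :: "nat \<Rightarrow> 'a \<Rightarrow> 'b::real_normed_vector set"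
  assumes V: "\<And>n. V n \<in> Lp_Pkc 2 M" and cui: "compactly_uniformly_integrable 1 M V"
  obtains R where "\<And>n. expectation (\<lambda>\<omega>. set_norm (V n \<omega>)) \<le> R"
proof -
  interpret P: Metric_space "Pk :: 'b set set" Pk_dist by (rule Metric_space_Pk_dist)
  have rv: "Pkc_random_variable M (V n)" for n using V by (rule Lp_Pkc_random_variable)
  obtain K where K: "compactin P.mtopology K"
    and small: "\<And>n. (\<integral>\<^sup>+\<omega>. ennreal (set_norm (V n \<omega>) powr 1) * indicator {\<omega>. V n \<omega> \<notin> K} \<omega> \<partial>M) < ennreal 1"
    using cui unfolding compactly_uniformly_integrable_def using zero_less_one by blast
  obtain A0 b where A0: "K \<subseteq> P.mcball A0 b"
    using P.compactin_imp_mbounded[OF K] by (auto simp: P.mbounded_def)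
  \<comment> \<open>A compact family is bounded in the Hausdorff metric, so the triangle inequality
    from \<open>{0}\<close> bounds the set norms on \<open>K\<close>; the \<open>max\<close> makes
    \<open>r\<close> nonnegative.\<close>
  define r where "r = max 0 (Pk_dist {0} A0 + b)"
  have r: "set_norm A \<le> r" if "A \<in> K" for A
  proof -
    have A: "A0 \<in> Pk" "A \<in> Pk" "Pk_dist A0 A \<le> b" using A0 that by (auto simp: P.in_mcball)
    have z: "{0::'b} \<in> Pk" by (simp add: Pk_def)
    have "set_norm A = Pk_dist {0} A" using A z by (simp add: set_norm_def Pk_dist_def)
    also have "\<dots> \<le> Pk_dist {0} A0 + Pk_dist A0 A" using A z by (intro P.triangle)
    finally show ?thesis using A(3) by (simp add: r_def)
  qed
  show ?thesis
  proof (rule that)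
    fix n
    let ?N = "\<lambda>\<omega>. set_norm (V n \<omega>)"
    let ?E = "\<lambda>\<omega>. max 0 (?N \<omega> - r)"
    have int: "integrable M ?N" using V by (rule integrable_set_norm)
    then have intE: "integrable M ?E" by (intro Bochner_Integration.integrable_max) auto
    have "ennreal (expectation ?E) = (\<integral>\<^sup>+\<omega>. ennreal (?E \<omega>) \<partial>M)"
      by (rule nn_integral_eq_integral[symmetric, OF intE]) simp
    \<comment> \<open>On \<open>K\<close> the truncation vanishes; off \<open>K\<close> it is at
      most the set norm.\<close>
    also have "\<dots> \<le> (\<integral>\<^sup>+\<omega>. ennreal (?N \<omega> powr 1) * indicator {\<omega>. V n \<omega> \<notin> K} \<omega> \<partial>M)"
    proof (rule nn_integral_mono)
      fix \<omega> assume "\<omega> \<in> space M"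
      then have "0 \<le> ?N \<omega>" using Pkc_random_variableD(4)[OF rv] set_norm_nonneg by blast
      moreover have "0 \<le> r" by (simp add: r_def)
      ultimately show "ennreal (?E \<omega>) \<le> ennreal (?N \<omega> powr 1) * indicator {\<omega>. V n \<omega> \<notin> K} \<omega>"
        using r[of "V n \<omega>"] by (auto simp: indicator_def max_def intro!: ennreal_leI)
    qed
    also have "\<dots> < ennreal 1" by (rule small)
    finally have E: "expectation ?E \<le> 1" by (simp add: ennreal_less_iff)
    have "expectation ?N \<le> expectation (\<lambda>\<omega>. r + ?E \<omega>)"
      using int intE by (intro integral_mono) auto
    also have "\<dots> = r + expectation ?E" using intE by (simp add: prob_space)
    finally show "expectation ?N \<le> r + 1" using E by simp
  qed
qed

end

section \<open>Strong law for support functions and passage to sets\<close>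

text \<open>The variance bound is given on the unit sphere, while rational combinations of
  coordinates are not normalised; positive homogeneity transfers it with the factor
  \<open>(norm x)\<^sup>2\<close>.\<close>

lemma (in prob_space) support_fun_SLLN:
  fixes V :: "nat \<Rightarrow> 'a \<Rightarrow> 'b::real_normed_vector set"
  assumes V: "\<And>n. V n \<in> Lp_Pkc 2 M" and uncor: "uncorrelated_seq M V"
    and var: "\<And>n x. norm x = 1 \<Longrightarrow> variance (\<lambda>\<omega>. support_fun x (V n \<omega>)) \<le> C"
  shows "AE \<omega> in M. (\<lambda>n. (\<Sum>k<n. support_fun x (V k \<omega>)
    - expectation (\<lambda>\<omega>. support_fun x (V k \<omega>))) / real n) \<longlonglongrightarrow> 0"
proof (rule uncorrelated_SLLN)
  fix k
  have rv: "Pkc_random_variable M (V n)" for n using V by (rule Lp_Pkc_random_variable)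
  show "random_variable borel (\<lambda>\<omega>. support_fun x (V k \<omega>))"
    using rv by (rule borel_measurable_support_fun)
  show "integrable M (\<lambda>\<omega>. (support_fun x (V k \<omega>))\<^sup>2)"
    using V by (rule integrable_support_fun_square)
  show "variance (\<lambda>\<omega>. support_fun x (V k \<omega>)) \<le> (norm x)\<^sup>2 * C"
  proof (cases "x = 0")
    case True
    have zero: "support_fun x (V k \<omega>) = 0" if "\<omega> \<in> space M" for \<omega>
      using Pkc_random_variableD(1)[OF rv that] True by (simp add: support_fun_zero)
    then have "expectation (\<lambda>\<omega>. support_fun x (V k \<omega>)) = 0"
      by (simp cong: Bochner_Integration.integral_cong)
    then show ?thesis using zero True by (simp cong: Bochner_Integration.integral_cong)
  next
    case False
    define y where "y = (1 / norm x) *\<^sub>R x"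
    have y: "norm y = 1" "x = norm x *\<^sub>R y" using False by (simp_all add: y_def)
    have eq: "support_fun x (V k \<omega>) = norm x * support_fun y (V k \<omega>)" if "\<omega> \<in> space M" for \<omega>
      using support_fun_scaled_functional[OF Pkc_random_variableD(1,2)[OF rv that], of "norm x" y k] y(2)
      by simp
    have E: "expectation (\<lambda>\<omega>. support_fun x (V k \<omega>)) = norm x * expectation (\<lambda>\<omega>. support_fun y (V k \<omega>))"
      using eq by (simp cong: Bochner_Integration.integral_cong)
    have "variance (\<lambda>\<omega>. support_fun x (V k \<omega>)) = expectation (\<lambda>\<omega>. (norm x)\<^sup>2 *
        (support_fun y (V k \<omega>) - expectation (\<lambda>\<omega>. support_fun y (V k \<omega>)))\<^sup>2)"
      unfolding E using eq
      by (intro Bochner_Integration.integral_cong) (simp_all add: power_mult_distrib flip: right_diff_distrib)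
    also have "\<dots> = (norm x)\<^sup>2 * variance (\<lambda>\<omega>. support_fun y (V k \<omega>))" by simp
    also have "\<dots> \<le> (norm x)\<^sup>2 * C" using var[OF y(1)] by (intro mult_left_mono) auto
    finally show ?thesis .
  qed
next
  fix i j :: nat assume "i \<noteq> j"
  then show "covariance M (\<lambda>\<omega>. support_fun x (V i \<omega>)) (\<lambda>\<omega>. support_fun x (V j \<omega>)) = 0"
    using uncor by (simp add: uncorrelated_seq_def)
qed

theorem theorem4p5:
  fixes M :: "'w measure"
    and V :: "nat \<Rightarrow> 'w \<Rightarrow> 'a::{banach, second_countable_topology} set"
    and C :: real
  assumes "prob_space M" and "complete_measure M" and "nonatomic M"
    and "\<exists>B :: 'a set. finite B \<and> span B = UNIV"
    and "\<And>n. Pkc_random_variable M (V n)"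
    and "uncorrelated_seq M V"
    and "compactly_uniformly_integrable 1 M V"
    and "\<And>n. V n \<in> Lp_Pkc 2 M"
    and "C > 0"
    and "\<And>n x. norm x = 1 \<Longrightarrow> prob_space.variance M (\<lambda>\<omega>. support_fun x (V n \<omega>)) \<le> C"
  shows "AE \<omega> in M.
    (\<lambda>n. hausdorff_dist ((*\<^sub>R) (1 / real n) ` (\<Sum>k<n. V k \<omega>))
                        ((*\<^sub>R) (1 / real n) ` (\<Sum>k<n. aumann_expectation M (V k)))) \<longlonglongrightarrow> 0"
proof -
  interpret prob_space M by fact
  note V = \<open>\<And>n. V n \<in> Lp_Pkc 2 M\<close>
  have rv: "Pkc_random_variable M (V n)" for n by fact
  obtain B :: "'a set" where "finite B" "span B = UNIV" using assms(4) by blast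
  then obtain I :: "'a set" and \<phi> :: "'a \<Rightarrow> 'a \<Rightarrow>\<^sub>L real" and c
    where I: "finite I" and c: "\<And>y. norm y \<le> c * (\<Sum>i\<in>I. \<bar>\<phi> i y\<bar>)" "0 < c"
    using finite_dim_coordinate_functionals by metis
  obtain R where R: "\<And>n. expectation (\<lambda>\<omega>. set_norm (V n \<omega>)) \<le> R"
    using compactly_uniformly_integrable_bound[OF V assms(7)] by blast
  let ?E = "\<lambda>k. aumann_expectation M (V k)"
  have R_E: "norm a \<le> R" if "a \<in> ?E k" for a k
    using norm_le_in_aumann_expectation[OF V that] R[of k] by simp
  have E: "?E k \<noteq> {}" "bounded (?E k)" "convex (?E k)" for k
    using aumann_expectation_nonempty[OF V] R_E[of _ k] boundedI convex_aumann_expectation[OF rv]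
    by blast+
  have R0: "0 \<le> R" using R_E E(1) norm_ge_zero order_trans by blast
  let ?x = "\<lambda>q. \<Sum>i\<in>I. q i *\<^sub>R \<phi> i"
  \<comment> \<open>One null set serves all rational coefficient families: extensional functions
    from the finite \<open>I\<close> to the rationals form a countable set.\<close>
  have "AE \<omega> in M. \<forall>x\<in>?x ` (I \<rightarrow>\<^sub>E \<rat>). (\<lambda>n. (\<Sum>k<n. support_fun x (V k \<omega>)
      - expectation (\<lambda>\<omega>. support_fun x (V k \<omega>))) / real n) \<longlonglongrightarrow> 0"
    using I by (subst AE_ball_countable)
      (auto intro!: countable_image countable_PiE countable_rat support_fun_SLLN[OF V assms(6,10)])
  then show ?thesis using AE_space
  proof eventually_elim
    case (elim \<omega>)
    have V\<omega>: "V k \<omega> \<noteq> {}" "bounded (V k \<omega>)" "convex (V k \<omega>)" for k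
      using Pkc_random_variableD[OF rv elim(2)] by blast+
    have sumV: "(\<Sum>k<n. V k \<omega>) \<noteq> {}" "bounded (\<Sum>k<n. V k \<omega>)" for n
      using set_sum_nonempty_bounded[of "{..<n}" "\<lambda>k. V k \<omega>"] V\<omega> by auto
    have sumE: "(\<Sum>k<n. ?E k) \<noteq> {}" "bounded (\<Sum>k<n. ?E k)" for n
      using set_sum_nonempty_bounded[of "{..<n}" ?E] E by auto
    show ?case
    proof (rule hausdorff_dist_tendsto_0[OF I c])
      fix n
      show "convex ((*\<^sub>R) (1 / real n) ` (\<Sum>k<n. V k \<omega>))"
        by (intro convex_scaling convex_set_sum V\<omega>)
      show "convex ((*\<^sub>R) (1 / real n) ` (\<Sum>k<n. ?E k))"
        by (intro convex_scaling convex_set_sum E)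
      show "bounded ((*\<^sub>R) (1 / real n) ` (\<Sum>k<n. V k \<omega>))"
        by (intro bounded_scaling sumV)
      show "(*\<^sub>R) (1 / real n) ` (\<Sum>k<n. V k \<omega>) \<noteq> {}" "(*\<^sub>R) (1 / real n) ` (\<Sum>k<n. ?E k) \<noteq> {}"
        using sumV(1) sumE(1) by auto
      fix b assume "b \<in> (*\<^sub>R) (1 / real n) ` (\<Sum>k<n. ?E k)"
      then obtain a where a: "a \<in> (\<Sum>k<n. ?E k)" "b = (1 / real n) *\<^sub>R a" by blast
      have "norm a \<le> (\<Sum>k<n. R)" using norm_le_in_set_sum[OF R_E _ a(1)] by simp
      \<comment> \<open>At \<open>n = 0\<close> the point \<open>b\<close> is 0, and the claim is
        \<open>0 \<le> R\<close>.\<close>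
      then show "norm b \<le> R" using R0 by (cases "n = 0") (simp_all add: a(2) field_simps)
    next
      fix q :: "'a \<Rightarrow> real" assume "\<And>i. i \<in> I \<Longrightarrow> q i \<in> \<rat>"
      then have "?x (restrict q I) \<in> ?x ` (I \<rightarrow>\<^sub>E \<rat>)" by (intro imageI) auto
      moreover have "?x (restrict q I) = ?x q" by (intro sum.cong) auto
      ultimately have lim: "(\<lambda>n. (\<Sum>k<n. support_fun (?x q) (V k \<omega>)
          - expectation (\<lambda>\<omega>. support_fun (?x q) (V k \<omega>))) / real n) \<longlonglongrightarrow> 0"
        using bspec[OF elim(1), of "?x q"] by (simp only:)
      then show "(\<lambda>n. support_fun (?x q) ((*\<^sub>R) (1 / real n) ` (\<Sum>k<n. V k \<omega>))
          - support_fun (?x q) ((*\<^sub>R) (1 / real n) ` (\<Sum>k<n. ?E k))) \<longlonglongrightarrow> 0"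
        using V\<omega> E
        by (simp add: support_fun_scaled_set sumV sumE support_fun_set_sum
            support_fun_aumann_expectation[OF V] sum_subtractf diff_divide_distrib)
    qed
  qed
qed

end
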